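(* Let $\mathfrak g$ be a 2-step nilpotent Lie algebra of dimension $d<\infty$ whose first Betti number is equal to $b$, and let $\alpha(\mathfrak g)$ be its independence number. Then $$\alpha(\mathfrak g)\le\frac12+\sqrt{\frac14+b^2+b-2d}\,.$$
   Context: 2-step nilpotent Lie algebra: a real vector space $\mathfrak g$ with an antisymmetric bilinear bracket $[\,,\,]:\mathfrak g\times\mathfrak g\to\mathfrak g$ such that $[x,[y,z]]=0$ for all $x,y,z\in\mathfrak g$ (abelian Lie algebras are included). Cohomology: the Cartan-Chevalley-Eilenberg complex of $\mathfrak g$ is the exterior algebra $\mathcal C^\bullet(\mathfrak g)=\bigwedge^\bullet\mathfrak g^\vee$ of the dual of $\mathfrak g$, with differential the odd derivation determined by $d(\varphi)(x,y)=\varphi([x,y])$ for $\varphi\in\mathfrak g^\vee$, $x,y\in\mathfrak g$ (this differential is not to be confused with the dimension $d$). $H^\bullet(\mathfrak g)$ is its cohomology, and the first Betti number is $b=b^1(\mathfrak g)=\dim H^1(\mathfrak g)$. Basic cohomology: let $\pi:\mathfrak g\to\mathfrak g/[\mathfrak g,\mathfrak g]$ be the canonical quotient map. $H^\bullet_B(\mathfrak g)$ is the image of the induced linear map $\pi^\bullet:H^\bullet(\mathfrak g/[\mathfrak g,\mathfrak g])\to H^\bullet(\mathfrak g)$, and $b^k_B(\mathfrak g)=\dim H^k_B(\mathfrak g)$. Independence number: $\alpha(\mathfrak g)$ is the largest integer $k$ such that $b^k_B(\mathfrak g)\ne0$. *)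

theory Defs
  imports "HOL-Analysis.Analysis"
begin

section \<open>Two-step nilpotent Lie algebras\<close>

class two_step_nilpotent_lie_algebra = real_vector +
  fixes lie_bracket :: "'a \<Rightarrow> 'a \<Rightarrow> 'a"
  assumes lie_bracket_add_left: "lie_bracket (x + y) z = lie_bracket x z + lie_bracket y z"
    and lie_bracket_scaleR_left: "lie_bracket (r *\<^sub>R x) y = r *\<^sub>R lie_bracket x y"
    and lie_bracket_antisym: "lie_bracket x y = - lie_bracket y x"
    and lie_bracket_2step: "lie_bracket x (lie_bracket y z) = 0"

lemma lie_bracket_self [simp]:
  "lie_bracket x x = (0 :: 'a :: two_step_nilpotent_lie_algebra)"
proof -
  have "(2 :: real) *\<^sub>R lie_bracket x x = 0"
    using lie_bracket_antisym[of x x] by (metis add.left_inverse scaleR_2)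
  then show ?thesis by simp
qed

lemma linear_lie_bracket_left: "linear (\<lambda>x. lie_bracket x y)"
  by (intro linearI lie_bracket_add_left lie_bracket_scaleR_left)

lemma linear_lie_bracket_right: "linear (lie_bracket x)"
proof -
  have "lie_bracket x = (\<lambda>y. - lie_bracket y x)"
    using lie_bracket_antisym by blast
  then show ?thesis
    using linear_compose_neg[OF linear_lie_bracket_left] by metis
qed

lemma bilinear_lie_bracket: "bilinear lie_bracket"
  by (simp add: bilinear_def linear_lie_bracket_left linear_lie_bracket_right)

lemma lie_bracket_diff_left: "lie_bracket (x - y) z = lie_bracket x z - lie_bracket y z"
  and lie_bracket_diff_right: "lie_bracket z (x - y) = lie_bracket z x - lie_bracket z y"
  by (simp_all add: linear_diff[OF linear_lie_bracket_left] linear_diff[OF linear_lie_bracket_right])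

lemma lie_bracket_zero [simp]: "lie_bracket x 0 = 0" "lie_bracket 0 x = 0"
  by (simp_all add: linear_0[OF linear_lie_bracket_left] linear_0[OF linear_lie_bracket_right])

subsection \<open>The quotient by the derived algebra\<close>

definition derived_algebra :: "'a :: two_step_nilpotent_lie_algebra set"
  where "derived_algebra = span {lie_bracket x y | x y. True}"

lemma subspace_derived_algebra: "subspace derived_algebra"
  by (simp add: derived_algebra_def subspace_span)

lemma lie_bracket_in_derived_algebra: "lie_bracket x y \<in> derived_algebra"
  unfolding derived_algebra_def by (rule span_base) blast

definition derived_rel :: "'a :: two_step_nilpotent_lie_algebra \<Rightarrow> 'a \<Rightarrow> bool"
  where "derived_rel x y \<longleftrightarrow> x - y \<in> derived_algebra"

lemma equivp_derived_rel: "equivp derived_rel"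
proof (rule equivpI)
  note S = subspace_derived_algebra
  show "reflp derived_rel"
    by (auto simp: reflp_def derived_rel_def subspace_0[OF S])
  show "symp derived_rel"
    unfolding symp_def derived_rel_def using subspace_neg[OF S] by (metis minus_diff_eq)
  show "transp derived_rel"
    unfolding transp_def derived_rel_def using subspace_add[OF S]
    by (metis diff_add_cancel add_diff_eq)
qed

quotient_type (overloaded) 'a abelianization =
  "'a :: two_step_nilpotent_lie_algebra" / derived_rel
  by (rule equivp_derived_rel)

text \<open>All operations are the induced ones, and \<open>abs_abelianization\<close> is the canonical
  projection.\<close>

instantiation abelianization ::
  (two_step_nilpotent_lie_algebra) two_step_nilpotent_lie_algebra
begin

lift_definition zero_abelianization :: "'a abelianization" is 0 .

lift_definition plus_abelianization ::
  "'a abelianization \<Rightarrow> 'a abelianization \<Rightarrow> 'a abelianization" is "(+)"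
  unfolding derived_rel_def using subspace_add[OF subspace_derived_algebra]
  by (metis add_diff_add)

lift_definition uminus_abelianization :: "'a abelianization \<Rightarrow> 'a abelianization" is uminus
  unfolding derived_rel_def using subspace_neg[OF subspace_derived_algebra]
  by (metis minus_diff_minus)

lift_definition minus_abelianization ::
  "'a abelianization \<Rightarrow> 'a abelianization \<Rightarrow> 'a abelianization" is "(-)"
  unfolding derived_rel_def using subspace_diff[OF subspace_derived_algebra]
  by (metis diff_diff_add diff_diff_eq2 diff_add_eq add.commute add_diff_add)

lift_definition scaleR_abelianization :: "real \<Rightarrow> 'a abelianization \<Rightarrow> 'a abelianization"
  is scaleR
  unfolding derived_rel_def using subspace_scale[OF subspace_derived_algebra]
  by (metis scaleR_diff_right)

lift_definition lie_bracket_abelianization ::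
  "'a abelianization \<Rightarrow> 'a abelianization \<Rightarrow> 'a abelianization" is lie_bracket
  unfolding derived_rel_def
  by (intro subspace_diff[OF subspace_derived_algebra] lie_bracket_in_derived_algebra)

instance
proof
  have *: "derived_rel x y" if "x = y" for x y :: 'a
    using that equivp_reflp[OF equivp_derived_rel] by simp
  fix a b c :: "'a abelianization" and r s :: real
  show "a + b + c = a + (b + c)" by transfer (simp add: * add.assoc)
  show "a + b = b + a" by transfer (simp add: * add.commute)
  show "0 + a = a" by transfer (simp add: *)
  show "- a + a = 0" by transfer (simp add: *)
  show "a - b = a + - b" by transfer (simp add: *)
  show "r *\<^sub>R (a + b) = r *\<^sub>R a + r *\<^sub>R b" by transfer (simp add: * scaleR_add_right)
  show "(r + s) *\<^sub>R a = r *\<^sub>R a + s *\<^sub>R a" by transfer (simp add: * scaleR_add_left)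
  show "r *\<^sub>R s *\<^sub>R a = (r * s) *\<^sub>R a" by transfer (simp add: *)
  show "1 *\<^sub>R a = a" by transfer (simp add: *)
  show "lie_bracket a b = - lie_bracket b a"
    by transfer (metis * lie_bracket_antisym)
  show "lie_bracket a (lie_bracket b c) = 0"
    by transfer (simp add: * lie_bracket_2step)
  show "lie_bracket (a + b) c = lie_bracket a c + lie_bracket b c"
    by transfer (simp add: * lie_bracket_add_left)
  show "lie_bracket (r *\<^sub>R a) b = r *\<^sub>R lie_bracket a b"
    by transfer (simp add: * lie_bracket_scaleR_left)
qed

end

section \<open>The Cartan--Chevalley--Eilenberg complex\<close>

subsection \<open>Alternating multilinear forms\<close>

definition multilinear_form :: "('a :: real_vector list \<Rightarrow> real) \<Rightarrow> bool"
  where "multilinear_form f \<longleftrightarrow> (\<forall>us vs. linear (\<lambda>x. f (us @ x # vs)))"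

definition alternating_form :: "('a list \<Rightarrow> real) \<Rightarrow> bool"
  where "alternating_form f \<longleftrightarrow> (\<forall>xs. \<not> distinct xs \<longrightarrow> f xs = 0)"

lemma multilinear_formD: "multilinear_form f \<Longrightarrow> linear (\<lambda>x. f (us @ x # vs))"
  by (simp add: multilinear_form_def)

lemma multilinear_form_Cons: "multilinear_form f \<Longrightarrow> multilinear_form (\<lambda>ys. f (x # ys))"
  unfolding multilinear_form_def
proof (intro allI)
  fix us vs assume "\<forall>us vs. linear (\<lambda>x. f (us @ x # vs))"
  then have "linear (\<lambda>y. f ((x # us) @ y # vs))" by (rule spec2)
  then show "linear (\<lambda>y. f (x # us @ y # vs))" by simp
qed

lemma alternating_form_Cons: "alternating_form f \<Longrightarrow> alternating_form (\<lambda>ys. f (x # ys))"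
  unfolding alternating_form_def by simp

lemma alternating_form_adjacent: "alternating_form f \<Longrightarrow> f (us @ x # x # vs) = 0"
  unfolding alternating_form_def by simp

lemma multilinear_form_swap:
  assumes "multilinear_form f" "\<And>us x vs. f (us @ x # x # vs) = 0"
  shows "f (us @ x # y # vs) = - f (us @ y # x # vs)"
proof -
  have 1: "f (us @ (a + b) # c # vs) = f (us @ a # c # vs) + f (us @ b # c # vs)" for a b c
    using linear_add[OF multilinear_formD[OF assms(1), of us "c # vs"]] by simp
  have 2: "f (us @ c # (a + b) # vs) = f (us @ c # a # vs) + f (us @ c # b # vs)" for a b c
    using linear_add[OF multilinear_formD[OF assms(1), of "us @ [c]" "vs"]] by simp
  show ?thesis
    using assms(2)[of us "x + y" vs] assms(2)[of us x vs] assms(2)[of us y vs]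
    unfolding 1 2 by linarith
qed

lemma alternating_formI:
  assumes "multilinear_form f" "\<And>us x vs. f (us @ x # x # vs) = 0"
  shows "alternating_form f"
proof -
  have "f (us @ x # ws @ x # vs) = 0" for us x ws vs
  proof (induction ws arbitrary: us)
    case (Cons w ws)
    show ?case
      using multilinear_form_swap[OF assms, of us x w "ws @ x # vs"] Cons[of "us @ [w]"] by simp
  qed (simp add: assms(2))
  note * = this
  show ?thesis
    unfolding alternating_form_def
  proof (intro allI impI)
    fix xs :: "'a list" assume "\<not> distinct xs"
    then obtain us x ws vs where "xs = us @ [x] @ ws @ [x] @ vs"
      using not_distinct_decomp by blast
    then show "f xs = 0" by (simp add: *)
  qed
qed

lemma multilinear_form_zero: "multilinear_form (\<lambda>_. 0)"
  by (simp add: multilinear_form_def linear_zero)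

lemma multilinear_form_add:
  "multilinear_form f \<Longrightarrow> multilinear_form g \<Longrightarrow> multilinear_form (\<lambda>xs. f xs + g xs)"
  by (simp add: multilinear_form_def linear_compose_add)

lemma multilinear_form_scale: "multilinear_form f \<Longrightarrow> multilinear_form (\<lambda>xs. r * f xs)"
  unfolding multilinear_form_def
  by (auto simp: linear_iff distrib_left)

lemma multilinear_form_neg: "multilinear_form f \<Longrightarrow> multilinear_form (\<lambda>xs. - f xs)"
  by (simp add: multilinear_form_def linear_compose_neg)

lemma multilinear_form_diff:
  "multilinear_form f \<Longrightarrow> multilinear_form g \<Longrightarrow> multilinear_form (\<lambda>xs. f xs - g xs)"
  by (simp add: multilinear_form_def linear_compose_sub)

text \<open>The direct sum over \<open>k\<close> of the spaces of alternating \<open>k\<close>-forms, a form of degree \<open>k\<close> being a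
  function on lists of length \<open>k\<close>.  For finite-dimensional \<open>'a\<close> this is the exterior algebra of the
  dual space; multilinearity is expressed slot by slot, and the value at \<open>[]\<close> is the degree-0
  component.\<close>

typedef (overloaded) 'a cochain =
  "{f :: 'a :: real_vector list \<Rightarrow> real. multilinear_form f \<and> alternating_form f \<and>
     (\<exists>N. \<forall>xs. N < length xs \<longrightarrow> f xs = 0)}"
  morphisms cochain_eval Abs_cochain
  by (rule exI[of _ "\<lambda>_. 0"]) (simp add: multilinear_form_zero alternating_form_def)

setup_lifting type_definition_cochain

instantiation cochain :: (real_vector) real_vector
begin

lift_definition zero_cochain :: "'a cochain" is "\<lambda>_. 0"
  by (simp add: multilinear_form_zero alternating_form_def)

lift_definition plus_cochain :: "'a cochain \<Rightarrow> 'a cochain \<Rightarrow> 'a cochain"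
  is "\<lambda>f g xs. f xs + g xs"
proof (elim conjE exE, intro conjI, goal_cases)
  case (3 f g N M)
  then show ?case by (intro exI[of _ "max N M"]) simp
qed (simp_all add: multilinear_form_add alternating_form_def)

lift_definition uminus_cochain :: "'a cochain \<Rightarrow> 'a cochain" is "\<lambda>f xs. - f xs"
  by (simp add: multilinear_form_neg alternating_form_def)

lift_definition minus_cochain :: "'a cochain \<Rightarrow> 'a cochain \<Rightarrow> 'a cochain"
  is "\<lambda>f g xs. f xs - g xs"
proof (elim conjE exE, intro conjI, goal_cases)
  case (3 f g N M)
  then show ?case by (intro exI[of _ "max N M"]) simp
qed (simp_all add: multilinear_form_diff alternating_form_def)

lift_definition scaleR_cochain :: "real \<Rightarrow> 'a cochain \<Rightarrow> 'a cochain" is "\<lambda>r f xs. r * f xs"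
proof (elim conjE exE, intro conjI, goal_cases)
  case (3 r f N)
  then show ?case by (intro exI[of _ N]) simp
qed (simp_all add: multilinear_form_scale alternating_form_def)

instance
  by standard (transfer, simp add: fun_eq_iff algebra_simps)+

end

definition homogeneous :: "nat \<Rightarrow> 'a :: real_vector cochain \<Rightarrow> bool"
  where "homogeneous k c \<longleftrightarrow> (\<forall>xs. length xs \<noteq> k \<longrightarrow> cochain_eval c xs = 0)"

subsection \<open>The wedge product\<close>

text \<open>The sign is that of the shuffle moving the positions in \<open>I\<close> to the front.\<close>

definition wedge_fun :: "('a list \<Rightarrow> real) \<Rightarrow> ('a list \<Rightarrow> real) \<Rightarrow> 'a list \<Rightarrow> real"
  where "wedge_fun f g xs =
    (\<Sum>I\<in>Pow {..<length xs}.
       (-1) ^ card {(i, j). i \<in> I \<and> j \<notin> I \<and> j < i} * f (nths xs I) * g (nths xs (- I)))"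

definition sign_twist :: "('a list \<Rightarrow> real) \<Rightarrow> 'a list \<Rightarrow> real"
  where "sign_twist f xs = (-1) ^ length xs * f xs"

lemma wedge_fun_Nil: "wedge_fun f g [] = f [] * g []"
  by (simp add: wedge_fun_def)

lemma wedge_fun_Cons:
  "wedge_fun f g (x # ys) =
     wedge_fun (\<lambda>zs. f (x # zs)) g ys + wedge_fun (sign_twist f) (\<lambda>zs. g (x # zs)) ys"
proof -
  define n where "n = length ys"
  define inv where "inv I = {(i, j). i \<in> I \<and> j \<notin> I \<and> j < i}" for I :: "nat set"
  define T where "T I = (-1) ^ card (inv I) * f (nths (x # ys) I) * g (nths (x # ys) (- I))" for I
  define A where "A = (\<lambda>I. insert 0 (Suc ` I)) ` Pow {..<n}"
  define B where "B = (\<lambda>I. Suc ` I) ` Pow {..<n}"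
  have Pow: "Pow {..<Suc n} = A \<union> B"
    unfolding A_def B_def lessThan_Suc_eq_insert_0 Pow_insert image_Pow_surj[OF refl, symmetric]
    by (auto simp: image_image)
  have inter: "A \<inter> B = {}" "finite A" "finite B"
    by (auto simp: A_def B_def)
  have suc: "{j. Suc j \<in> Suc ` I} = I" "{j. Suc j \<in> insert 0 (Suc ` I)} = I"
    "{j. Suc j \<in> - Suc ` I} = - I" "{j. Suc j \<in> - insert 0 (Suc ` I)} = - I"
    "{j. Suc j \<notin> Suc ` I} = - I" for I
    by auto
  have len: "length (nths ys I) = card I" if "I \<subseteq> {..<n}" for I
  proof -
    have "{i. i < length ys \<and> i \<in> I} = I"
      using that by (auto simp: n_def)
    then show ?thesis by (simp add: length_nths)
  qed
  have fin: "finite (inv I)" if "I \<subseteq> {..<n}" for I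
    by (rule finite_subset[of _ "{..<n} \<times> {..<n}"]) (use that in \<open>auto simp: inv_def\<close>)
  have injm: "inj_on (map_prod Suc Suc) X" "inj_on (\<lambda>i. (Suc i, 0)) Y" for X Y
    by (auto simp: inj_on_def)
  have invA: "card (inv (insert 0 (Suc ` I))) = card (inv I)" for I
  proof -
    have "inv (insert 0 (Suc ` I)) = map_prod Suc Suc ` inv I"
    proof (intro set_eqI, clarify, goal_cases)
      case (1 a b)
      show ?case by (cases a; cases b) (auto simp: inv_def image_iff)
    qed
    then show ?thesis by (simp add: card_image injm)
  qed
  have invB: "card (inv (Suc ` I)) = card (inv I) + card I" if "I \<subseteq> {..<n}" for I
  proof -
    have "inv (Suc ` I) = map_prod Suc Suc ` inv I \<union> (\<lambda>i. (Suc i, 0)) ` I"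
    proof (intro set_eqI, clarify, goal_cases)
      case (1 a b)
      show ?case by (cases a; cases b) (auto simp: inv_def image_iff)
    qed
    moreover have "finite I" using that finite_subset by blast
    moreover have "finite (inv I)" using fin[OF that] .
    ultimately show ?thesis
      by (simp, subst card_Un_disjoint) (auto simp: card_image injm)
  qed
  have "wedge_fun f g (x # ys) = sum T (Pow {..<Suc n})"
    by (simp add: wedge_fun_def T_def inv_def n_def)
  also have "\<dots> = sum T A + sum T B"
    unfolding Pow by (rule sum.union_disjoint) (use inter in auto)
  also have "sum T A = wedge_fun (\<lambda>zs. f (x # zs)) g ys"
  proof -
    have "inj_on (\<lambda>I. insert 0 (Suc ` I)) (Pow {..<n})"
      by (rule inj_onI) (metis suc(2))
    then show ?thesis
      unfolding A_def wedge_fun_def n_def[symmetric] inv_def[symmetric]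
      by (simp add: sum.reindex T_def nths_Cons suc invA)
  qed
  also have "sum T B = wedge_fun (sign_twist f) (\<lambda>zs. g (x # zs)) ys"
  proof -
    have "inj_on (\<lambda>I. Suc ` I) (Pow {..<n})"
      by (rule inj_onI) (metis suc(1))
    then show ?thesis
      unfolding B_def wedge_fun_def n_def[symmetric] inv_def[symmetric]
      by (simp add: sum.reindex) (intro sum.cong refl,
        auto simp: T_def nths_Cons suc invB len sign_twist_def power_add)
  qed
  finally show ?thesis .
qed

lemma linear_wedge_fun_left:
  assumes "\<And>zs. linear (\<lambda>x. F x zs)"
  shows "linear (\<lambda>x. wedge_fun (F x) g ys)"
proof -
  have "F (x + y) zs = F x zs + F y zs" "F (r *\<^sub>R x) zs = r * F x zs" for x y r zs
    using linear_add[OF assms] linear_scale[OF assms] by auto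
  then show ?thesis
    by (intro linearI) (simp_all add: wedge_fun_def algebra_simps sum.distrib sum_distrib_left)
qed

lemma linear_wedge_fun_right:
  assumes "\<And>zs. linear (\<lambda>x. F x zs)"
  shows "linear (\<lambda>x. wedge_fun g (F x) ys)"
proof -
  have "F (x + y) zs = F x zs + F y zs" "F (r *\<^sub>R x) zs = r * F x zs" for x y r zs
    using linear_add[OF assms] linear_scale[OF assms] by auto
  then show ?thesis
    by (intro linearI) (simp_all add: wedge_fun_def algebra_simps sum.distrib sum_distrib_left)
qed

lemma multilinear_form_Cons_linear: "multilinear_form f \<Longrightarrow> linear (\<lambda>x. f (x # vs))"
  using multilinear_formD[of f "[]"] by simp

lemma multilinear_form_sign_twist: "multilinear_form f \<Longrightarrow> multilinear_form (sign_twist f)"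
  by (auto simp: multilinear_form_def sign_twist_def linear_iff algebra_simps)

lemma alternating_form_sign_twist: "alternating_form f \<Longrightarrow> alternating_form (sign_twist f)"
  by (simp add: alternating_form_def sign_twist_def)

lemma sign_twist_Cons: "sign_twist f (x # ys) = - sign_twist (\<lambda>zs. f (x # zs)) ys"
  by (simp add: sign_twist_def)

lemma sign_twist_sign_twist [simp]: "sign_twist (sign_twist f) = f"
  by (simp add: sign_twist_def fun_eq_iff power_add[symmetric] flip: mult.assoc)

lemma wedge_fun_zero [simp]: "wedge_fun (\<lambda>_. 0) g ys = 0" "wedge_fun f (\<lambda>_. 0) ys = 0"
  by (simp_all add: wedge_fun_def)

lemma wedge_fun_neg [simp]: "wedge_fun (\<lambda>xs. - f xs) g ys = - wedge_fun f g ys"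
  "wedge_fun f (\<lambda>xs. - g xs) ys = - wedge_fun f g ys"
  by (simp_all add: wedge_fun_def sum_negf)

lemma wedge_fun_add:
  "wedge_fun (\<lambda>xs. f xs + g xs) h ys = wedge_fun f h ys + wedge_fun g h ys"
  "wedge_fun h (\<lambda>xs. f xs + g xs) ys = wedge_fun h f ys + wedge_fun h g ys"
  by (simp_all add: wedge_fun_def algebra_simps sum.distrib)

lemma wedge_fun_diff:
  "wedge_fun (\<lambda>xs. f xs - g xs) h ys = wedge_fun f h ys - wedge_fun g h ys"
  "wedge_fun h (\<lambda>xs. f xs - g xs) ys = wedge_fun h f ys - wedge_fun h g ys"
  by (simp_all add: wedge_fun_def algebra_simps sum_subtractf)

lemma multilinear_form_wedge:
  assumes "multilinear_form f" "multilinear_form g"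
  shows "multilinear_form (wedge_fun f g)"
proof -
  have "linear (\<lambda>x. wedge_fun f g (us @ x # vs))" for us vs
    using assms
  proof (induction us arbitrary: f g)
    case Nil
    then show ?case
      by (simp add: wedge_fun_Cons linear_compose_add linear_wedge_fun_left
          linear_wedge_fun_right multilinear_form_Cons_linear)
  next
    case (Cons u us)
    show ?case
      by (simp add: wedge_fun_Cons)
        (intro linear_compose_add Cons.IH multilinear_form_Cons multilinear_form_sign_twist Cons.prems)
  qed
  then show ?thesis by (simp add: multilinear_form_def)
qed

lemma alternating_form_wedge:
  assumes "multilinear_form f" "multilinear_form g" "alternating_form f" "alternating_form g"
  shows "alternating_form (wedge_fun f g)"
proof (rule alternating_formI[OF multilinear_form_wedge[OF assms(1,2)]])
  fix us x vs
  show "wedge_fun f g (us @ x # x # vs) = 0"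
    using assms(3,4)
  proof (induction us arbitrary: f g)
    case Nil
    have "(\<lambda>zs. f (x # x # zs)) = (\<lambda>_. 0)" "(\<lambda>zs. g (x # x # zs)) = (\<lambda>_. 0)"
      using Nil by (simp_all add: alternating_form_def)
    then show ?case by (simp add: wedge_fun_Cons sign_twist_Cons)
  next
    case (Cons u us)
    show ?case
      by (simp add: wedge_fun_Cons Cons.IH alternating_form_Cons alternating_form_sign_twist
          Cons.prems)
  qed
qed

lemma wedge_fun_eq_0:
  assumes "\<forall>xs. N < length xs \<longrightarrow> f xs = 0" "\<forall>xs. M < length xs \<longrightarrow> g xs = 0"
    and "N + M < length xs"
  shows "wedge_fun f g xs = 0"
  unfolding wedge_fun_def
proof (rule sum.neutral, safe)
  fix I :: "nat set"
  have "length (nths xs I) + length (nths xs (- I)) =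
      card ({i. i < length xs \<and> i \<in> I} \<union> {i. i < length xs \<and> i \<in> - I})"
    unfolding length_nths by (rule card_Un_disjoint[symmetric]) auto
  also have "{i. i < length xs \<and> i \<in> I} \<union> {i. i < length xs \<and> i \<in> - I} = {..<length xs}"
    by auto
  finally have "N < length (nths xs I) \<or> M < length (nths xs (- I))"
    using assms(3) by (simp add: length_nths, linarith)
  then show "(- 1) ^ card {(i, j). i \<in> I \<and> j \<notin> I \<and> j < i} * f (nths xs I) * g (nths xs (- I)) = 0"
    using assms(1,2) by auto
qed

lift_definition wedge :: "'a :: real_vector cochain \<Rightarrow> 'a cochain \<Rightarrow> 'a cochain" (infixl "\<and>\<^sub>c" 70)
  is wedge_fun
proof (elim conjE exE, intro conjI, goal_cases)
  case (3 f g N M)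
  then show ?case by (intro exI[of _ "N + M"]) (simp add: wedge_fun_eq_0)
qed (simp_all add: multilinear_form_wedge alternating_form_wedge)

subsection \<open>The differential\<close>

text \<open>The sign is fixed by \<open>(d \<phi>) [x, y] = \<phi> [lie_bracket x y]\<close> for 1-forms \<open>\<phi>\<close>; it is opposite to
  the one of the usual Chevalley--Eilenberg formula.  That this is the odd derivation determined
  by its values on 1-forms is shown in \<open>ce_d_wedge\<close> and \<open>ce_d_unique\<close> below.\<close>

definition ce_d_fun ::
  "('a :: two_step_nilpotent_lie_algebra list \<Rightarrow> real) \<Rightarrow> 'a list \<Rightarrow> real"
  where "ce_d_fun f xs =
    (\<Sum>j<length xs. \<Sum>i<j.
       (-1) ^ (i + j + 1) * f (lie_bracket (xs ! i) (xs ! j) # nths xs (- {i, j})))"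

definition lie_derivative ::
  "'a :: two_step_nilpotent_lie_algebra \<Rightarrow> ('a list \<Rightarrow> real) \<Rightarrow> 'a list \<Rightarrow> real"
  where "lie_derivative x f ys =
    (\<Sum>j<length ys. (-1) ^ j * f (lie_bracket x (ys ! j) # nths ys (- {j})))"

lemma ce_d_fun_Nil [simp]: "ce_d_fun f [] = 0"
  by (simp add: ce_d_fun_def)

lemma lie_derivative_Nil [simp]: "lie_derivative x f [] = 0"
  by (simp add: lie_derivative_def)

lemma alternating_swap:
  assumes "multilinear_form f" "alternating_form f"
  shows "f (x # y # zs) = - f (y # x # zs)"
  using multilinear_form_swap[OF assms(1) alternating_form_adjacent[OF assms(2)], of "[]" x y] by simp

lemma nths_Compl_aux: "{j. Suc j \<in> - {0}} = UNIV" "{j. Suc j \<in> - {Suc i}} = - {i}"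
  "{j. Suc j \<in> - {0, Suc i}} = - {i}" "{j. Suc j \<in> - {Suc i, Suc k}} = - {i, k}"
  "{j. j \<noteq> i} = - {i}" "{j. j \<noteq> i \<and> j \<noteq> k} = - {i, k}"
  by auto

lemma lie_derivative_Cons:
  assumes "multilinear_form f" "alternating_form f"
  shows "lie_derivative x f (y # ys) =
    f (lie_bracket x y # ys) + lie_derivative x (\<lambda>zs. f (y # zs)) ys"
  by (simp add: lie_derivative_def sum.lessThan_Suc_shift nths_Cons nths_Compl_aux nths_all
      alternating_swap[OF assms, of _ y] del: sum.lessThan_Suc flip: sum_negf)

lemma ce_d_fun_Cons:
  assumes "multilinear_form f" "alternating_form f"
  shows "ce_d_fun f (x # ys) = lie_derivative x f ys - ce_d_fun (\<lambda>zs. f (x # zs)) ys"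
  by (simp add: lie_derivative_def ce_d_fun_def sum.lessThan_Suc_shift nths_Cons nths_Compl_aux
      nths_all alternating_swap[OF assms, of _ x] sum.distrib sum_negf sum_subtractf
      del: sum.lessThan_Suc)

lemma lie_derivative_add:
  "lie_derivative x (\<lambda>xs. f xs + g xs) ys = lie_derivative x f ys + lie_derivative x g ys"
  by (simp add: lie_derivative_def distrib_left sum.distrib)

lemma lie_derivative_diff:
  "lie_derivative x (\<lambda>xs. f xs - g xs) ys = lie_derivative x f ys - lie_derivative x g ys"
  by (simp add: lie_derivative_def right_diff_distrib sum_subtractf)

lemma ce_d_fun_add: "ce_d_fun (\<lambda>xs. f xs + g xs) ys = ce_d_fun f ys + ce_d_fun g ys"
  by (simp only: ce_d_fun_def distrib_left sum.distrib)

lemma ce_d_fun_diff: "ce_d_fun (\<lambda>xs. f xs - g xs) ys = ce_d_fun f ys - ce_d_fun g ys"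
  by (simp only: ce_d_fun_def right_diff_distrib sum_subtractf)

lemma ce_d_fun_scale: "ce_d_fun (\<lambda>xs. r * f xs) ys = r * ce_d_fun f ys"
  by (simp only: ce_d_fun_def mult.left_commute[of _ r] sum_distrib_left)

lemma linear_lie_derivative:
  assumes "\<And>zs. linear (\<lambda>x. F x zs)"
  shows "linear (\<lambda>x. lie_derivative y (F x) ys)"
proof -
  have "F (x + y) zs = F x zs + F y zs" "F (r *\<^sub>R x) zs = r * F x zs" for x y r zs
    using linear_add[OF assms] linear_scale[OF assms] by auto
  then show ?thesis
    by (intro linearI) (simp_all add: lie_derivative_def algebra_simps sum.distrib sum_distrib_left)
qed

lemma ce_d_fun_neg: "ce_d_fun (\<lambda>xs. - f xs) ys = - ce_d_fun f ys"
  using ce_d_fun_scale[of "-1" f ys] by simp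

lemma linear_ce_d_fun:
  assumes "\<And>zs. linear (\<lambda>x. F x zs)"
  shows "linear (\<lambda>x. ce_d_fun (F x) ys)"
proof -
  have "F (x + y) = (\<lambda>zs. F x zs + F y zs)" "F (r *\<^sub>R x) = (\<lambda>zs. r * F x zs)" for x y r
    using linear_add[OF assms] linear_scale[OF assms] by auto
  then show ?thesis
    by (intro linearI) (simp_all add: ce_d_fun_add ce_d_fun_scale)
qed

lemma linear_form_bracket_right: "multilinear_form f \<Longrightarrow> linear (\<lambda>x. f (lie_bracket y x # vs))"
  using linear_compose[OF linear_lie_bracket_right multilinear_form_Cons_linear]
  by (simp add: o_def)

lemma linear_form_bracket_left: "multilinear_form f \<Longrightarrow> linear (\<lambda>x. f (lie_bracket x y # vs))"
  using linear_compose[OF linear_lie_bracket_left multilinear_form_Cons_linear]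
  by (simp add: o_def)

lemma multilinear_lie_derivative:
  assumes "multilinear_form f" "alternating_form f"
  shows "linear (\<lambda>x. lie_derivative x f ys)" "multilinear_form (lie_derivative y f)"
proof -
  show "linear (\<lambda>x. lie_derivative x f ys)"
    unfolding lie_derivative_def
    by (intro linear_compose_sum ballI linear_compose_scale_right[where 'b = real, simplified]
        linear_form_bracket_left assms)
  have "linear (\<lambda>x. lie_derivative y f (us @ x # vs))" for us vs
    using assms
  proof (induction us arbitrary: f)
    case Nil
    then show ?case
      by (simp add: lie_derivative_Cons linear_compose_add linear_lie_derivative
          multilinear_form_Cons_linear linear_form_bracket_right)
  next
    case (Cons u us)
    have "linear (\<lambda>x. f ((lie_bracket y u # us) @ x # vs))"
      by (rule multilinear_formD[OF Cons.prems(1)])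
    then show ?case
      by (simp add: lie_derivative_Cons Cons.prems linear_compose_add Cons.IH
          multilinear_form_Cons alternating_form_Cons)
  qed
  then show "multilinear_form (lie_derivative y f)" by (simp add: multilinear_form_def)
qed

lemma lie_derivative_adjacent:
  assumes "multilinear_form f" "alternating_form f"
  shows "lie_derivative y f (us @ x # x # vs) = 0"
  using assms
proof (induction us arbitrary: f)
  case Nil
  have "(\<lambda>zs. f (x # x # zs)) = (\<lambda>_. 0)"
    using Nil by (simp add: alternating_form_def)
  then show ?case
    using alternating_swap[OF Nil, of x "lie_bracket y x" vs] Nil
    by (simp add: lie_derivative_Cons multilinear_form_Cons alternating_form_Cons)
      (simp add: lie_derivative_def)
next
  case (Cons u us)
  have "f ((lie_bracket y u # us) @ x # x # vs) = 0"
    by (rule alternating_form_adjacent[OF Cons.prems(2)])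
  then show ?case
    by (simp add: lie_derivative_Cons Cons multilinear_form_Cons alternating_form_Cons)
qed

lemma alternating_lie_derivative:
  assumes "multilinear_form f" "alternating_form f"
  shows "alternating_form (lie_derivative y f)"
  by (intro alternating_formI multilinear_lie_derivative lie_derivative_adjacent assms)

lemma multilinear_form_ce_d:
  assumes "multilinear_form f" "alternating_form f"
  shows "multilinear_form (ce_d_fun f)"
proof -
  have "linear (\<lambda>x. ce_d_fun f (us @ x # vs))" for us vs
    using assms
  proof (induction us arbitrary: f)
    case Nil
    then show ?case
      by (simp add: ce_d_fun_Cons linear_compose_sub multilinear_lie_derivative linear_ce_d_fun
          multilinear_form_Cons_linear)
  next
    case (Cons u us)
    then show ?case
      by (simp add: ce_d_fun_Cons linear_compose_sub multilinear_formD multilinear_lie_derivative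
          multilinear_form_Cons alternating_form_Cons)
  qed
  then show ?thesis by (simp add: multilinear_form_def)
qed

lemma alternating_form_ce_d:
  assumes "multilinear_form f" "alternating_form f"
  shows "alternating_form (ce_d_fun f)"
proof (rule alternating_formI[OF multilinear_form_ce_d[OF assms]])
  fix us x vs
  show "ce_d_fun f (us @ x # x # vs) = 0"
    using assms
  proof (induction us arbitrary: f)
    case Nil
    have "(\<lambda>zs. f (x # x # zs)) = (\<lambda>_. 0)"
      using Nil by (simp add: alternating_form_def)
    moreover have "f (0 # vs) = 0"
      using linear_0[OF multilinear_form_Cons_linear[OF Nil(1)]] .
    ultimately show ?case
      using Nil
      by (simp add: ce_d_fun_Cons lie_derivative_Cons multilinear_form_Cons alternating_form_Cons)
        (simp add: ce_d_fun_def)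
  next
    case (Cons u us)
    then show ?case
      by (simp add: ce_d_fun_Cons lie_derivative_adjacent multilinear_form_Cons
          alternating_form_Cons)
  qed
qed

lemma ce_d_fun_eq_0:
  assumes "\<forall>xs. N < length xs \<longrightarrow> f xs = 0" "Suc N < length xs"
  shows "ce_d_fun f xs = 0"
  unfolding ce_d_fun_def
proof (intro sum.neutral ballI)
  fix j i assume ij: "j \<in> {..<length xs}" "i \<in> {..<j}"
  have "{k. k < length xs \<and> k \<in> - {i, j}} = {..<length xs} - {i, j}" by auto
  then have "length (nths xs (- {i, j})) = length xs - 2"
    using ij by (simp add: length_nths card_Diff_subset)
  then show "(- 1) ^ (i + j + 1) * f (lie_bracket (xs ! i) (xs ! j) # nths xs (- {i, j})) = 0"
    using assms by simp
qed

lift_definition ce_d :: "'a :: two_step_nilpotent_lie_algebra cochain \<Rightarrow> 'a cochain"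
  is ce_d_fun
proof (elim conjE exE, intro conjI, goal_cases)
  case (3 f N)
  then show ?case by (intro exI[of _ "Suc N"]) (simp add: ce_d_fun_eq_0)
qed (simp_all add: multilinear_form_ce_d alternating_form_ce_d)

lemma linear_ce_d: "linear ce_d"
proof (rule linearI)
  show "ce_d (c + e) = ce_d c + ce_d e" for c e :: "'a cochain"
    by transfer (simp add: fun_eq_iff ce_d_fun_add)
  show "ce_d (r *\<^sub>R c) = r *\<^sub>R ce_d c" for r and c :: "'a cochain"
    by transfer (simp add: fun_eq_iff ce_d_fun_scale)
qed

lemma ce_d_1_form: "cochain_eval (ce_d \<phi>) [x, y] = cochain_eval \<phi> [lie_bracket x y]"
  by transfer (simp add: ce_d_fun_def nths_Cons lessThan_Suc)

lemma length_nths_Compl_single: "j < length ys \<Longrightarrow> Suc (length (nths ys (- {j}))) = length ys"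
proof -
  assume j: "j < length ys"
  have "{k. k < length ys \<and> k \<in> - {j}} = {..<length ys} - {j}" by auto
  then show ?thesis using j by (simp add: length_nths)
qed

lemma lie_derivative_sign_twist: "lie_derivative x (sign_twist f) ys = sign_twist (lie_derivative x f) ys"
  unfolding lie_derivative_def sign_twist_def sum_distrib_left
  by (intro sum.cong refl) (simp add: length_nths_Compl_single)

lemma ce_d_fun_sign_twist:
  assumes "multilinear_form f" "alternating_form f"
  shows "ce_d_fun (sign_twist f) ys = - sign_twist (ce_d_fun f) ys"
  using assms
proof (induction ys arbitrary: f)
  case (Cons y ys)
  have "ce_d_fun (\<lambda>zs. sign_twist f (y # zs)) ys = sign_twist (ce_d_fun (\<lambda>zs. f (y # zs))) ys"
    using Cons.IH[OF multilinear_form_Cons alternating_form_Cons, OF Cons.prems]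
    by (simp add: sign_twist_Cons ce_d_fun_neg)
  then show ?case
    using Cons.prems
    by (simp add: ce_d_fun_Cons multilinear_form_sign_twist alternating_form_sign_twist
        lie_derivative_sign_twist)
      (simp add: sign_twist_def ce_d_fun_Cons algebra_simps)
qed (simp add: sign_twist_def)

lemma lie_derivative_wedge:
  assumes "multilinear_form f" "alternating_form f" "multilinear_form g" "alternating_form g"
  shows "lie_derivative x (wedge_fun f g) ys =
    wedge_fun (lie_derivative x f) g ys + wedge_fun f (lie_derivative x g) ys"
  using assms
proof (induction ys arbitrary: f g)
  case (Cons y ys)
  have tw: "sign_twist (lie_derivative x f) = lie_derivative x (sign_twist f)"
    by (simp add: fun_eq_iff lie_derivative_sign_twist)
  show ?case
    using Cons.prems
    by (simp add: lie_derivative_Cons multilinear_form_wedge alternating_form_wedge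
        wedge_fun_Cons lie_derivative_add Cons.IH multilinear_form_Cons alternating_form_Cons
        multilinear_form_sign_twist alternating_form_sign_twist wedge_fun_add tw)
qed (simp add: wedge_fun_Nil)

lemma ce_d_fun_wedge:
  assumes "multilinear_form f" "alternating_form f" "multilinear_form g" "alternating_form g"
  shows "ce_d_fun (wedge_fun f g) ys =
    wedge_fun (ce_d_fun f) g ys + wedge_fun (sign_twist f) (ce_d_fun g) ys"
  using assms
proof (induction ys arbitrary: f g)
  case (Cons y ys)
  have tw: "ce_d_fun (sign_twist f) = (\<lambda>zs. - sign_twist (ce_d_fun f) zs)"
    using Cons.prems by (simp add: fun_eq_iff ce_d_fun_sign_twist)
  show ?case
    using Cons.prems
    by (simp add: ce_d_fun_Cons multilinear_form_wedge alternating_form_wedge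
        lie_derivative_wedge wedge_fun_Cons ce_d_fun_add Cons.IH multilinear_form_Cons
        alternating_form_Cons multilinear_form_sign_twist alternating_form_sign_twist tw
        wedge_fun_diff sign_twist_Cons)
qed (simp add: wedge_fun_Nil sign_twist_def)

lemma lie_derivative_bracket:
  assumes "multilinear_form f"
  shows "lie_derivative (lie_bracket x y) f ys = 0"
proof -
  have "lie_bracket (lie_bracket x y) z = 0" for z
    using lie_bracket_antisym[of "lie_bracket x y" z] by (simp add: lie_bracket_2step)
  then show ?thesis
    using linear_0[OF multilinear_form_Cons_linear[OF assms]] by (simp add: lie_derivative_def)
qed

lemma lie_derivative_commute:
  assumes "multilinear_form f" "alternating_form f"
  shows "lie_derivative x (lie_derivative y f) zs = lie_derivative y (lie_derivative x f) zs"
  using assms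
proof (induction zs arbitrary: f)
  case (Cons z zs)
  have "f (0 # zs) = 0"
    using linear_0[OF multilinear_form_Cons_linear[OF Cons.prems(1)]] .
  then show ?case
    using Cons
    by (simp add: lie_derivative_Cons multilinear_lie_derivative alternating_lie_derivative
        lie_derivative_add lie_bracket_2step multilinear_form_Cons alternating_form_Cons)
qed simp

lemma lie_derivative_ce_d:
  assumes "multilinear_form f" "alternating_form f"
  shows "lie_derivative x (ce_d_fun f) ys = ce_d_fun (lie_derivative x f) ys"
  using assms
proof (induction ys arbitrary: f)
  case (Cons y ys)
  then show ?case
    using lie_derivative_commute[OF Cons.prems, of x y ys]
    by (simp add: lie_derivative_Cons ce_d_fun_Cons multilinear_lie_derivative
        alternating_lie_derivative multilinear_form_ce_d alternating_form_ce_d ce_d_fun_add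
        lie_derivative_bracket lie_derivative_diff multilinear_form_Cons alternating_form_Cons)
qed simp

lemma ce_d_fun_ce_d_fun:
  assumes "multilinear_form f" "alternating_form f"
  shows "ce_d_fun (ce_d_fun f) ys = 0"
  using assms
proof (induction ys arbitrary: f)
  case (Cons y ys)
  then show ?case
    by (simp add: ce_d_fun_Cons multilinear_form_ce_d alternating_form_ce_d ce_d_fun_diff
        lie_derivative_ce_d multilinear_form_Cons alternating_form_Cons)
qed simp

lemma ce_d_ce_d [simp]: "ce_d (ce_d c) = 0"
  by transfer (simp add: fun_eq_iff ce_d_fun_ce_d_fun)

lemma ce_d_wedge:
  assumes "homogeneous p c"
  shows "ce_d (c \<and>\<^sub>c e) = ce_d c \<and>\<^sub>c e + (-1) ^ p *\<^sub>R (c \<and>\<^sub>c ce_d e)"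
proof -
  have "sign_twist (cochain_eval c) = (\<lambda>xs. (-1) ^ p * cochain_eval c xs)"
    using assms by (auto simp: fun_eq_iff sign_twist_def homogeneous_def)
  then show ?thesis
    by transfer (simp add: fun_eq_iff ce_d_fun_wedge, simp add: wedge_fun_def sum_distrib_left mult_ac)
qed

lemma homogeneous_ce_d: "homogeneous k c \<Longrightarrow> homogeneous (Suc k) (ce_d c)"
  unfolding homogeneous_def
proof (transfer, intro allI impI)
  fix k and c :: "'a list \<Rightarrow> real" and xs :: "'a list"
  assume c: "\<forall>xs. length xs \<noteq> k \<longrightarrow> c xs = 0" and xs: "length xs \<noteq> Suc k"
  have "c (lie_bracket (xs ! i) (xs ! j) # nths xs (- {i, j})) = 0"
    if "j < length xs" "i < j" for i j
  proof -
    have "{k. k < length xs \<and> k \<in> - {i, j}} = {..<length xs} - {i, j}" by auto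
    then have "length (nths xs (- {i, j})) = length xs - 2"
      using that by (simp add: length_nths card_Diff_subset)
    then show ?thesis using c xs that by simp
  qed
  then show "ce_d_fun c xs = 0" by (simp add: ce_d_fun_def)
qed

subsection \<open>Uniqueness of the differential\<close>

lift_definition one_cochain :: "'a :: real_vector cochain" is "\<lambda>xs. if xs = [] then 1 else 0"
  by (auto simp: multilinear_form_def alternating_form_def linear_zero intro!: exI[of _ 0])

lift_definition contract :: "'a :: real_vector \<Rightarrow> 'a cochain \<Rightarrow> 'a cochain" is "\<lambda>x f ys. f (x # ys)"
proof (elim conjE exE, intro conjI, goal_cases)
  case (3 x f N)
  then show ?case by (intro exI[of _ N]) simp
qed (simp_all add: multilinear_form_Cons alternating_form_Cons)

lift_definition component :: "nat \<Rightarrow> 'a :: real_vector cochain \<Rightarrow> 'a cochain"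
  is "\<lambda>k f xs. if length xs = k then f xs else 0"
proof (elim conjE exE, intro conjI, goal_cases)
  case (1 k f N)
  show ?case
    unfolding multilinear_form_def
  proof (intro allI)
    fix us vs
    show "linear (\<lambda>x. if length (us @ x # vs) = k then f (us @ x # vs) else 0)"
      by (cases "Suc (length us + length vs) = k")
        (simp_all add: linear_zero multilinear_formD[OF 1(1)])
  qed
next
  case (3 k f N)
  then show ?case by (intro exI[of _ N]) simp
qed (simp add: alternating_form_def)

lift_definition one_form :: "('a :: real_vector \<Rightarrow> real) \<Rightarrow> 'a cochain"
  is "\<lambda>\<phi> xs. if linear \<phi> \<and> length xs = 1 then \<phi> (hd xs) else 0"
proof (intro conjI, goal_cases)
  case (1 \<phi>)
  show ?case
    unfolding multilinear_form_def
  proof (intro allI)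
    fix us vs
    show "linear (\<lambda>x. if linear \<phi> \<and> length (us @ x # vs) = 1 then \<phi> (hd (us @ x # vs)) else 0)"
      by (cases "linear \<phi> \<and> us = [] \<and> vs = []") (auto simp: linear_zero)
  qed
next
  case (2 \<phi>)
  show ?case by (auto simp: alternating_form_def length_Suc_conv)
next
  case (3 \<phi>)
  show ?case by (intro exI[of _ 1]) auto
qed

lemma wedge_one_left: "one_cochain \<and>\<^sub>c c = c"
proof transfer
  fix c :: "'a list \<Rightarrow> real"
  have "wedge_fun (\<lambda>xs. if xs = [] then 1 else 0) c xs = c xs" for xs
  proof (induction xs arbitrary: c)
    case (Cons x xs)
    have "sign_twist (\<lambda>xs :: 'a list. if xs = [] then 1 else 0) = (\<lambda>xs. if xs = [] then 1 else 0)"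
      by (auto simp: sign_twist_def)
    then show ?case by (simp add: wedge_fun_Cons Cons)
  qed (simp add: wedge_fun_Nil)
  then show "wedge_fun (\<lambda>xs. if xs = [] then 1 else 0) c = c" by blast
qed

lemma wedge_one_right: "c \<and>\<^sub>c one_cochain = c"
proof transfer
  fix c :: "'a list \<Rightarrow> real"
  have "wedge_fun c (\<lambda>xs. if xs = [] then 1 else 0) xs = c xs" for xs
    by (induction xs arbitrary: c) (simp_all add: wedge_fun_Nil wedge_fun_Cons)
  then show "wedge_fun c (\<lambda>xs. if xs = [] then 1 else 0) = c" by blast
qed

lemma wedge_zero [simp]: "c \<and>\<^sub>c 0 = 0" "0 \<and>\<^sub>c c = 0"
  by (transfer; simp add: fun_eq_iff)+

lemma cochain_eval_sum: "cochain_eval (sum c A) xs = (\<Sum>a\<in>A. cochain_eval (c a) xs)"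
  by (induction A rule: infinite_finite_induct) (simp_all add: zero_cochain.rep_eq plus_cochain.rep_eq)

lemma sum_component:
  obtains N where "c = (\<Sum>k\<le>N. component k c)"
proof -
  obtain N where N: "\<forall>xs. N < length xs \<longrightarrow> cochain_eval c xs = 0"
    using cochain_eval[of c] by blast
  have "c = (\<Sum>k\<le>N. component k c)"
  proof (rule cochain_eval_inject[THEN iffD1], rule ext)
    fix xs
    show "cochain_eval c xs = cochain_eval (\<Sum>k\<le>N. component k c) xs"
      using N by (auto simp: cochain_eval_sum component.rep_eq sum.delta)
  qed
  then show thesis by (rule that)
qed

lemma homogeneous_eq_sum_wedge:
  fixes B :: "'a :: real_vector set"
  assumes B: "finite B" "independent B" "span B = UNIV" and c: "homogeneous k c"
  shows "real k *\<^sub>R c = (\<Sum>b\<in>B. one_form (\<lambda>x. representation B x b) \<and>\<^sub>c contract b c)"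
proof -
  define \<phi> where "\<phi> b x = representation B x b" for b x
  define F where "F b zs = (if length zs = 1 then \<phi> b (hd zs) else 0)" for b and zs :: "'a list"
  have lin: "linear (\<phi> b)" for b
    unfolding \<phi>_def
    using B by (intro linearI) (simp_all add: representation_add representation_scale)
  have expand: "(\<Sum>b\<in>B. \<phi> b x *\<^sub>R b) = x" for x
    unfolding \<phi>_def using sum_representation_eq[of B x B] B by simp
  have tw: "sign_twist (F b) = (\<lambda>zs. - F b zs)" for b
    by (auto simp: fun_eq_iff sign_twist_def F_def)
  have FC: "(\<lambda>zs. F b (x # zs)) = (\<lambda>zs. \<phi> b x * (if zs = [] then 1 else 0))" for b x
    by (auto simp: F_def fun_eq_iff)
  have one: "wedge_fun (\<lambda>zs. r * (if zs = [] then 1 else 0)) g xs = r * g xs"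
    for g and r :: real and xs :: "'a list"
  proof (induction xs arbitrary: g)
    case (Cons x xs)
    have "sign_twist (\<lambda>zs :: 'a list. r * (if zs = [] then 1 else 0)) = (\<lambda>zs. r * (if zs = [] then 1 else 0))"
      by (auto simp: sign_twist_def)
    then show ?case by (simp add: wedge_fun_Cons Cons)
  qed (simp add: wedge_fun_Nil)
  have *: "(\<Sum>b\<in>B. wedge_fun (F b) (\<lambda>zs. f (b # zs)) xs) = length xs * f xs"
    if "multilinear_form f" "alternating_form f" for f :: "'a list \<Rightarrow> real" and xs
    using that
  proof (induction xs arbitrary: f)
    case (Cons x ys)
    have sw: "(\<lambda>zs. f (b # x # zs)) = (\<lambda>zs. - f (x # b # zs))" for b
      using alternating_swap[OF Cons.prems] by blast
    have "(\<Sum>b\<in>B. \<phi> b x * f (b # ys)) = f ((\<Sum>b\<in>B. \<phi> b x *\<^sub>R b) # ys)"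
      using linear_sum[OF multilinear_form_Cons_linear[OF Cons.prems(1), of ys], of "\<lambda>b. \<phi> b x *\<^sub>R b" B]
        linear_scale[OF multilinear_form_Cons_linear[OF Cons.prems(1), of ys]]
      by simp
    then show ?case
      using Cons.IH[OF multilinear_form_Cons alternating_form_Cons, OF Cons.prems, of x]
      by (simp only: wedge_fun_Cons tw FC one sum.distrib sw wedge_fun_neg expand)
        (simp add: algebra_simps)
  qed (simp add: wedge_fun_Nil F_def)
  have oF: "cochain_eval (one_form (\<phi> b)) = F b" for b
    by (simp add: one_form.rep_eq lin F_def fun_eq_iff)
  show ?thesis
  proof (rule cochain_eval_inject[THEN iffD1], rule ext)
    fix xs
    have "cochain_eval (\<Sum>b\<in>B. one_form (\<phi> b) \<and>\<^sub>c contract b c) xs = length xs * cochain_eval c xs"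
      using *[of "cochain_eval c" xs] cochain_eval[of c]
      by (simp add: cochain_eval_sum wedge.rep_eq oF contract.rep_eq)
    then show "cochain_eval (real k *\<^sub>R c) xs =
        cochain_eval (\<Sum>b\<in>B. one_form (\<lambda>x. representation B x b) \<and>\<^sub>c contract b c) xs"
      using c by (auto simp: \<phi>_def[abs_def] scaleR_cochain.rep_eq homogeneous_def)
  qed
qed

lemma ce_d_unique:
  fixes D :: "'a :: two_step_nilpotent_lie_algebra cochain \<Rightarrow> 'a cochain"
  assumes fin: "\<exists>B :: 'a set. finite B \<and> span B = UNIV"
    and D: "linear D"
    and derivation: "\<And>p c e. homogeneous p c \<Longrightarrow>
      D (c \<and>\<^sub>c e) = D c \<and>\<^sub>c e + (-1) ^ p *\<^sub>R (c \<and>\<^sub>c D e)"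
    and D_1: "\<And>\<phi> x y. homogeneous 1 \<phi> \<Longrightarrow>
      homogeneous 2 (D \<phi>) \<and> cochain_eval (D \<phi>) [x, y] = cochain_eval \<phi> [lie_bracket x y]"
  shows "D = ce_d"
proof -
  obtain B0 :: "'a set" where B0: "finite B0" "span B0 = UNIV"
    using fin by blast
  obtain B where B': "B \<subseteq> B0" "independent B" "B0 \<subseteq> span B"
    by (rule maximal_independent_subset)
  have B: "finite B" "independent B" "span B = UNIV"
    using B' B0 finite_subset span_minimal[OF B'(3) subspace_span] by auto
  have hom: "homogeneous k c \<Longrightarrow> D c = ce_d c" for k and c :: "'a cochain"
  proof (induction k arbitrary: c)
    case 0
    have c: "c = cochain_eval c [] *\<^sub>R one_cochain"
      using 0 by (intro cochain_eval_inject[THEN iffD1] ext)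
        (auto simp: scaleR_cochain.rep_eq one_cochain.rep_eq homogeneous_def)
    have h: "homogeneous 0 (one_cochain :: 'a cochain)"
      by (simp add: homogeneous_def one_cochain.rep_eq)
    have "D one_cochain = 0" "ce_d (one_cochain :: 'a cochain) = 0"
      using derivation[OF h, of one_cochain] ce_d_wedge[OF h, of one_cochain]
      by (simp_all add: wedge_one_left wedge_one_right)
    then show ?case
      by (subst (1 2) c) (simp add: linear_scale[OF D] linear_scale[OF linear_ce_d])
  next
    case (Suc k)
    define \<phi> where "\<phi> b = one_form (\<lambda>x. representation B x b)" for b
    have h1: "homogeneous 1 (\<phi> b)" for b
      by (simp add: \<phi>_def homogeneous_def one_form.rep_eq)
    have h2: "homogeneous k (contract b c)" for b
      using Suc.prems by (simp add: homogeneous_def contract.rep_eq)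
    have D1: "D (\<phi> b) = ce_d (\<phi> b)" for b
    proof (rule cochain_eval_inject[THEN iffD1], rule ext)
      fix xs
      show "cochain_eval (D (\<phi> b)) xs = cochain_eval (ce_d (\<phi> b)) xs"
      proof (cases "length xs = 2")
        case True
        then obtain x y where "xs = [x, y]" by (auto simp: length_Suc_conv numeral_2_eq_2)
        then show ?thesis using D_1[OF h1] by (simp add: ce_d_1_form)
      next
        case False
        then show ?thesis
          using D_1[OF h1, of b] homogeneous_ce_d[OF h1, of b]
          by (simp add: homogeneous_def numeral_2_eq_2)
      qed
    qed
    have "real (Suc k) *\<^sub>R D c = D (\<Sum>b\<in>B. \<phi> b \<and>\<^sub>c contract b c)"
      unfolding \<phi>_def homogeneous_eq_sum_wedge[OF B Suc.prems, symmetric]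
      by (rule linear_scale[OF D, symmetric])
    also have "\<dots> = ce_d (\<Sum>b\<in>B. \<phi> b \<and>\<^sub>c contract b c)"
      by (simp add: linear_sum[OF D] linear_sum[OF linear_ce_d] derivation[OF h1]
          ce_d_wedge[OF h1] D1 Suc.IH[OF h2])
    also have "\<dots> = real (Suc k) *\<^sub>R ce_d c"
      unfolding \<phi>_def homogeneous_eq_sum_wedge[OF B Suc.prems, symmetric]
      by (rule linear_scale[OF linear_ce_d])
    finally show ?case by simp
  qed
  show ?thesis
  proof
    fix c :: "'a cochain"
    obtain N where N: "c = (\<Sum>k\<le>N. component k c)" by (rule sum_component)
    have "D (component k c) = ce_d (component k c)" for k
      by (rule hom[of k]) (simp add: homogeneous_def component.rep_eq)
    then show "D c = ce_d c"
      by (subst (1 2) N) (simp only: linear_sum[OF D] linear_sum[OF linear_ce_d])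
  qed
qed

section \<open>Cohomology\<close>

definition cohomologous :: "'a :: two_step_nilpotent_lie_algebra cochain \<Rightarrow> 'a cochain \<Rightarrow> bool"
  where "cohomologous c e \<longleftrightarrow> ce_d c = 0 \<and> ce_d e = 0 \<and> c - e \<in> range ce_d"

lemma subspace_range_ce_d: "subspace (range ce_d)"
  by (simp add: linear_subspace_image linear_ce_d)

lemmas ce_d_linear_simps =
  linear_0[OF linear_ce_d] linear_add[OF linear_ce_d] linear_diff[OF linear_ce_d]
  linear_neg[OF linear_ce_d] linear_scale[OF linear_ce_d]

lemma cohomologous_refl: "ce_d c = 0 \<Longrightarrow> cohomologous c c"
  using subspace_0[OF subspace_range_ce_d] by (simp add: cohomologous_def)

lemma cohomologous_sym:
  assumes "cohomologous c e" shows "cohomologous e c"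
proof -
  have "- (c - e) \<in> range ce_d"
    using assms by (intro subspace_neg[OF subspace_range_ce_d]) (simp add: cohomologous_def)
  then show ?thesis using assms by (simp add: cohomologous_def)
qed

lemma cohomologous_trans:
  assumes "cohomologous c e" "cohomologous e h" shows "cohomologous c h"
proof -
  have "(c - e) + (e - h) \<in> range ce_d"
    using assms by (intro subspace_add[OF subspace_range_ce_d]) (simp_all add: cohomologous_def)
  then show ?thesis using assms by (simp add: cohomologous_def)
qed

lemma part_equivp_cohomologous: "part_equivp cohomologous"
proof (rule part_equivpI)
  show "\<exists>c. cohomologous c c"
    using cohomologous_refl[of 0] by (auto simp: ce_d_linear_simps)
  show "symp cohomologous" by (rule sympI) (rule cohomologous_sym)
  show "transp cohomologous" by (rule transpI) (rule cohomologous_trans)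
qed

text \<open>The total cohomology \<open>ker ce_d / range ce_d\<close>.\<close>

quotient_type (overloaded) 'a cohomology =
  "'a :: two_step_nilpotent_lie_algebra cochain" / partial: cohomologous
  by (rule part_equivp_cohomologous)

instantiation cohomology :: (two_step_nilpotent_lie_algebra) real_vector
begin

lift_definition zero_cohomology :: "'a cohomology" is 0
  by (rule cohomologous_refl) (simp add: ce_d_linear_simps)

lift_definition plus_cohomology :: "'a cohomology \<Rightarrow> 'a cohomology \<Rightarrow> 'a cohomology" is "(+)"
  unfolding cohomologous_def
proof (elim conjE, intro conjI)
  fix a b c e :: "'a cochain"
  assume "a - b \<in> range ce_d" "c - e \<in> range ce_d"
  then have "(a - b) + (c - e) \<in> range ce_d" by (rule subspace_add[OF subspace_range_ce_d])
  then show "a + c - (b + e) \<in> range ce_d" by (simp add: algebra_simps)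
qed (simp_all add: ce_d_linear_simps)

lift_definition uminus_cohomology :: "'a cohomology \<Rightarrow> 'a cohomology" is uminus
  unfolding cohomologous_def
proof (elim conjE, intro conjI)
  fix a b :: "'a cochain"
  assume "a - b \<in> range ce_d"
  then have "- (a - b) \<in> range ce_d" by (rule subspace_neg[OF subspace_range_ce_d])
  then show "- a - - b \<in> range ce_d" by simp
qed (simp_all add: ce_d_linear_simps)

lift_definition minus_cohomology :: "'a cohomology \<Rightarrow> 'a cohomology \<Rightarrow> 'a cohomology" is "(-)"
  unfolding cohomologous_def
proof (elim conjE, intro conjI)
  fix a b c e :: "'a cochain"
  assume "a - b \<in> range ce_d" "c - e \<in> range ce_d"
  then have "(a - b) - (c - e) \<in> range ce_d" by (rule subspace_diff[OF subspace_range_ce_d])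
  then show "a - c - (b - e) \<in> range ce_d" by (simp add: algebra_simps)
qed (simp_all add: ce_d_linear_simps)

lift_definition scaleR_cohomology :: "real \<Rightarrow> 'a cohomology \<Rightarrow> 'a cohomology" is scaleR
  unfolding cohomologous_def
proof (elim conjE, intro conjI)
  fix r and a b :: "'a cochain"
  assume "a - b \<in> range ce_d"
  then have "r *\<^sub>R (a - b) \<in> range ce_d" by (rule subspace_scale[OF subspace_range_ce_d])
  then show "r *\<^sub>R a - r *\<^sub>R b \<in> range ce_d" by (simp add: scaleR_diff_right)
qed (simp_all add: ce_d_linear_simps)

instance
proof
  fix a b c :: "'a cohomology" and r s :: real
  note simps = cohomologous_def ce_d_linear_simps subspace_0[OF subspace_range_ce_d]
  show "a + b + c = a + (b + c)" by transfer (simp add: simps add.assoc)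
  show "a + b = b + a" by transfer (simp add: simps add.commute)
  show "0 + a = a" by transfer (simp add: simps)
  show "- a + a = 0" by transfer (simp add: simps)
  show "a - b = a + - b" by transfer (simp add: simps)
  show "r *\<^sub>R (a + b) = r *\<^sub>R a + r *\<^sub>R b" by transfer (simp add: simps scaleR_add_right)
  show "(r + s) *\<^sub>R a = r *\<^sub>R a + s *\<^sub>R a" by transfer (simp add: simps scaleR_add_left)
  show "r *\<^sub>R s *\<^sub>R a = (r * s) *\<^sub>R a" by transfer (simp add: simps)
  show "1 *\<^sub>R a = a" by transfer (simp add: simps)
qed

end

definition cohomology_degree ::
  "nat \<Rightarrow> 'a :: two_step_nilpotent_lie_algebra cohomology set" where
  "cohomology_degree k = abs_cohomology ` {c. homogeneous k c \<and> ce_d c = 0}"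

definition betti :: "'a :: two_step_nilpotent_lie_algebra itself \<Rightarrow> nat \<Rightarrow> nat"
  where "betti _ k = dim (cohomology_degree k :: 'a cohomology set)"

subsection \<open>Basic cohomology and the independence number\<close>

lemma linear_abs_abelianization: "linear abs_abelianization"
  by (intro linearI) (simp_all add: plus_abelianization.abs_eq scaleR_abelianization.abs_eq)

lift_definition cochain_pullback ::
  "'a :: two_step_nilpotent_lie_algebra abelianization cochain \<Rightarrow> 'a cochain"
  is "\<lambda>f xs. f (map abs_abelianization xs)"
proof (elim conjE exE, intro conjI, goal_cases)
  case (1 f N)
  show ?case
    unfolding multilinear_form_def
    using linear_compose[OF linear_abs_abelianization multilinear_formD[OF 1(1)]]
    by (simp add: o_def)
next
  case (2 f N)
  then show ?case by (simp add: alternating_form_def distinct_map)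
next
  case (3 f N)
  then show ?case by (intro exI[of _ N]) simp
qed

lemma ce_d_cochain_pullback: "ce_d (cochain_pullback c) = cochain_pullback (ce_d c)"
  by transfer (simp add: fun_eq_iff ce_d_fun_def nths_map lie_bracket_abelianization.abs_eq)

lemma linear_cochain_pullback: "linear cochain_pullback"
  by (intro linearI; transfer) (simp_all add: fun_eq_iff)

lift_definition cohomology_pullback ::
  "'a :: two_step_nilpotent_lie_algebra abelianization cohomology \<Rightarrow> 'a cohomology"
  is cochain_pullback
  unfolding cohomologous_def
proof (elim conjE, intro conjI)
  fix c e :: "'a abelianization cochain"
  assume "c - e \<in> range ce_d"
  then obtain h where "c - e = ce_d h" by blast
  then have "cochain_pullback c - cochain_pullback e = ce_d (cochain_pullback h)"
    by (simp add: ce_d_cochain_pullback flip: linear_diff[OF linear_cochain_pullback])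
  then show "cochain_pullback c - cochain_pullback e \<in> range ce_d" by blast
qed (simp_all add: ce_d_cochain_pullback linear_0[OF linear_cochain_pullback])

definition basic_cohomology_degree ::
  "nat \<Rightarrow> 'a :: two_step_nilpotent_lie_algebra cohomology set"
  where "basic_cohomology_degree k = cohomology_pullback ` cohomology_degree k"

definition basic_betti :: "'a :: two_step_nilpotent_lie_algebra itself \<Rightarrow> nat \<Rightarrow> nat"
  where "basic_betti _ k = dim (basic_cohomology_degree k :: 'a cohomology set)"

text \<open>Only used for finite-dimensional \<open>'a\<close>, where the maximum exists: \<open>basic_betti\<close> is nonzero at
  \<open>k = 0\<close> and vanishes above the dimension.\<close>

definition independence_number :: "'a :: two_step_nilpotent_lie_algebra itself \<Rightarrow> nat"
  where "independence_number T = (GREATEST k. basic_betti T k \<noteq> 0)"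


end

theory Submission
  imports Defs
begin

text \<open>Write \<open>K\<close> for the derived algebra of \<open>g\<close> and \<open>V = g / K\<close>.  Fix a basis of \<open>g\<close> extending a basis
  of \<open>K\<close>.  The coordinate forms of the added vectors are closed; they number \<open>b\<close> and their monomials
  \<open>\<theta>\<^sub>S\<close>, for \<open>S\<close> a set of added vectors, form a basis of the forms pulled back from \<open>V\<close>.  The coordinate
  forms of \<open>K\<close> have differentials in the span of the \<open>\<theta>\<^sub>P\<close> with \<open>\<bar>P\<bar> = 2\<close>, because \<open>K\<close> is central.  These
  \<open>d - b\<close> differentials are linearly independent, because a closed 1-form vanishes on brackets and
  hence on \<open>K\<close>.

  If the basic cohomology is nonzero in degree \<open>\<alpha>\<close>, then some \<open>\<theta>\<^sub>S\<close> with \<open>\<bar>S\<bar> = \<alpha>\<close> is not exact.  The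
  point is that no nonzero combination of the \<open>\<theta>\<^sub>P\<close> with \<open>P \<subseteq> S\<close>, \<open>\<bar>P\<bar> = 2\<close>, is exact.  Indeed, suppose
  \<open>d \<phi> + (\<Sum>\<^sub>P c\<^sub>P \<theta>\<^sub>P) = 0\<close> for a 1-form \<open>\<phi>\<close>, and multiply by \<open>\<theta>\<close> of the complement of one pair \<open>P\<close> in \<open>S\<close>.  Any other
  pair in \<open>S\<close> meets that complement, so the sum becomes \<open>\<plusminus> c\<^sub>P \<theta>\<^sub>S\<close>, whereas \<open>d \<phi>\<close> times a closed form
  is exact; hence \<open>c\<^sub>P = 0\<close>.  So the differentials together with the \<open>\<theta>\<^sub>P\<close> form a linearly independent
  family in a space of dimension \<open>b choose 2\<close>, and
  \<open>(d - b) + (\<alpha> choose 2) \<le> (b choose 2)\<close>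
  (\<open>non_exact_monomial_bound\<close>).  Completing the square gives the theorem.\<close>

section \<open>The exterior algebra\<close>

lemma cochain_eqI: "(\<And>xs. cochain_eval c xs = cochain_eval e xs) \<Longrightarrow> c = e"
  by (metis cochain_eval_inject ext)

lemma wedge_add: "(c + c') \<and>\<^sub>c e = c \<and>\<^sub>c e + c' \<and>\<^sub>c e" "e \<and>\<^sub>c (c + c') = e \<and>\<^sub>c c + e \<and>\<^sub>c c'"
  by (rule cochain_eqI; simp add: wedge.rep_eq plus_cochain.rep_eq wedge_fun_add)+

lemma wedge_scaleR: "(r *\<^sub>R c) \<and>\<^sub>c e = r *\<^sub>R (c \<and>\<^sub>c e)" "e \<and>\<^sub>c (r *\<^sub>R c) = r *\<^sub>R (e \<and>\<^sub>c c)"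
  by (rule cochain_eqI;
      simp add: wedge.rep_eq scaleR_cochain.rep_eq wedge_fun_def sum_distrib_left mult_ac)+

lemma linear_wedge: "linear (\<lambda>c. c \<and>\<^sub>c e)" "linear (\<lambda>c. e \<and>\<^sub>c c)"
  by (intro linearI wedge_add wedge_scaleR)+

lemma sign_twist_wedge_fun:
  "sign_twist (wedge_fun f g) xs = wedge_fun (sign_twist f) (sign_twist g) xs"
proof (induction xs arbitrary: f g)
  case Nil
  then show ?case by (simp add: sign_twist_def wedge_fun_Nil)
next
  case (Cons x xs)
  have *: "(\<lambda>zs. sign_twist f (x # zs)) = (\<lambda>zs. - sign_twist (\<lambda>zs. f (x # zs)) zs)" for f
    by (simp add: sign_twist_Cons fun_eq_iff)
  have "sign_twist (wedge_fun f g) (x # xs) =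
      - sign_twist (wedge_fun (\<lambda>zs. f (x # zs)) g) xs
      - sign_twist (wedge_fun (sign_twist f) (\<lambda>zs. g (x # zs))) xs"
    by (simp add: sign_twist_def wedge_fun_Cons algebra_simps)
  then show ?case
    by (simp add: wedge_fun_Cons Cons.IH *)
qed

text \<open>Identities between wedge products are proved by induction on the argument list: removing the
  head of the list is contraction, which is an odd derivation.\<close>

lemma wedge_assoc: "(c \<and>\<^sub>c e) \<and>\<^sub>c h = c \<and>\<^sub>c (e \<and>\<^sub>c h)"
proof -
  have "wedge_fun (wedge_fun f g) k xs = wedge_fun f (wedge_fun g k) xs"
    for f g k :: "'a list \<Rightarrow> real" and xs
  proof (induction xs arbitrary: f g k)
    case (Cons x xs)
    have "sign_twist (wedge_fun f g) = wedge_fun (sign_twist f) (sign_twist g)"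
      by (rule ext) (rule sign_twist_wedge_fun)
    then show ?case
      by (simp add: wedge_fun_Cons wedge_fun_add Cons.IH)
  qed (simp add: wedge_fun_Nil)
  then show ?thesis
    by (intro cochain_eqI) (simp add: wedge.rep_eq eta_contract_eq)
qed

lemma cochain_eval_contract [simp]: "cochain_eval (contract x c) ys = cochain_eval c (x # ys)"
  by (simp add: contract.rep_eq)

lemma contract_scaleR: "contract x (r *\<^sub>R c) = r *\<^sub>R contract x c"
  by (rule cochain_eqI) (simp add: scaleR_cochain.rep_eq)

lemma contract_swap: "contract x (contract y c) = - contract y (contract x c)"
  using cochain_eval[of c]
  by (intro cochain_eqI) (auto simp: uminus_cochain.rep_eq intro!: alternating_swap)

lemma contract_one_form_wedge:
  assumes "linear \<phi>"
  shows "contract x (one_form \<phi> \<and>\<^sub>c c) = \<phi> x *\<^sub>R c - one_form \<phi> \<and>\<^sub>c contract x c"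
proof (rule cochain_eqI)
  fix ys
  have 1: "(\<lambda>zs. cochain_eval (one_form \<phi>) (x # zs)) = cochain_eval (\<phi> x *\<^sub>R one_cochain)"
    using assms by (auto simp: one_form.rep_eq one_cochain.rep_eq scaleR_cochain.rep_eq)
  have 2: "sign_twist (cochain_eval (one_form \<phi>)) = cochain_eval (- one_form \<phi>)"
    by (auto simp: sign_twist_def one_form.rep_eq uminus_cochain.rep_eq)
  have "cochain_eval (one_form \<phi> \<and>\<^sub>c c) (x # ys) =
      cochain_eval ((\<phi> x *\<^sub>R one_cochain) \<and>\<^sub>c c + (- one_form \<phi>) \<and>\<^sub>c contract x c) ys"
    by (simp add: wedge.rep_eq wedge_fun_Cons 1 2 plus_cochain.rep_eq contract.rep_eq)
  also have "\<dots> = cochain_eval (\<phi> x *\<^sub>R c - one_form \<phi> \<and>\<^sub>c contract x c) ys"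
    using linear_neg[OF linear_wedge(1), of "one_form \<phi>" "contract x c"]
    by (simp add: wedge_scaleR wedge_one_left)
  finally show "cochain_eval (contract x (one_form \<phi> \<and>\<^sub>c c)) ys = \<dots>" by simp
qed

lemma one_form_wedge_self: "one_form \<phi> \<and>\<^sub>c (one_form \<phi> \<and>\<^sub>c c) = 0"
proof (cases "linear \<phi>")
  case True
  have "cochain_eval (one_form \<phi> \<and>\<^sub>c (one_form \<phi> \<and>\<^sub>c c)) xs = 0" for xs
  proof (induction xs arbitrary: c)
    case Nil
    then show ?case by (simp add: wedge.rep_eq wedge_fun_Nil one_form.rep_eq)
  next
    case (Cons x xs)
    have "contract x (one_form \<phi> \<and>\<^sub>c (one_form \<phi> \<and>\<^sub>c c)) =
        one_form \<phi> \<and>\<^sub>c (one_form \<phi> \<and>\<^sub>c contract x c)"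
      by (simp add: contract_one_form_wedge True linear_diff[OF linear_wedge(2)] wedge_scaleR)
    then show ?case using Cons by (metis cochain_eval_contract)
  qed
  then show ?thesis by (intro cochain_eqI) (simp add: zero_cochain.rep_eq)
next
  case False
  then have "one_form \<phi> = 0" by (intro cochain_eqI) (simp add: one_form.rep_eq zero_cochain.rep_eq)
  then show ?thesis by simp
qed

lemma one_form_wedge_anticommute:
  assumes "linear \<phi>" "linear \<psi>"
  shows "one_form \<phi> \<and>\<^sub>c (one_form \<psi> \<and>\<^sub>c c) = - (one_form \<psi> \<and>\<^sub>c (one_form \<phi> \<and>\<^sub>c c))"
proof -
  have "one_form (\<lambda>x. \<phi> x + \<psi> x) = one_form \<phi> + one_form \<psi>"
    using assms by (intro cochain_eqI) (simp add: one_form.rep_eq plus_cochain.rep_eq linear_compose_add)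
  then show ?thesis
    using one_form_wedge_self[of "\<lambda>x. \<phi> x + \<psi> x" c]
    by (simp add: wedge_add one_form_wedge_self eq_neg_iff_add_eq_0 add.commute)
qed

lemma homogeneous_one_form: "homogeneous 1 (one_form \<phi>)"
  by (simp add: homogeneous_def one_form.rep_eq)

lemma homogeneous_one_cochain: "homogeneous 0 one_cochain"
  by (simp add: homogeneous_def one_cochain.rep_eq)

lemma homogeneous_sum:
  "(\<And>i. i \<in> I \<Longrightarrow> homogeneous k (f i)) \<Longrightarrow> homogeneous k (\<Sum>i\<in>I. r i *\<^sub>R f i)"
  by (simp add: homogeneous_def cochain_eval_sum scaleR_cochain.rep_eq)

section \<open>Closed forms of low degree\<close>

lemma ce_d_one_cochain: "ce_d one_cochain = 0"
  using ce_d_wedge[OF homogeneous_one_cochain, of one_cochain]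
  by (simp add: wedge_one_left wedge_one_right)

lemma linear_cochain_eval_singleton: "linear (\<lambda>x. cochain_eval c [x])"
  using cochain_eval[of c] by (auto intro: multilinear_form_Cons_linear)

text \<open>By \<open>d \<phi> (x, y) = \<phi> [x, y]\<close>, the degree-1 part of a closed form vanishes on brackets.  This
  identifies \<open>H\<^sup>1\<close>, and it is also why \<open>d\<close> is injective on the coordinate forms of the derived
  algebra.\<close>

lemma closed_one_form_vanishes:
  fixes c :: "'a :: two_step_nilpotent_lie_algebra cochain"
  assumes "ce_d c = 0" "x \<in> derived_algebra"
  shows "cochain_eval c [x] = 0"
  using assms(2) unfolding derived_algebra_def
proof (rule linear_eq_0_on_span[OF linear_cochain_eval_singleton, rotated])
  fix z :: 'a assume "z \<in> {lie_bracket x y |x y. True}"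
  then obtain x y where "z = lie_bracket x y" by blast
  then show "cochain_eval c [z] = 0"
    using ce_d_1_form[of c x y] assms(1) by (simp add: zero_cochain.rep_eq)
qed

lemma derived_algebra_central:
  assumes "x \<in> derived_algebra"
  shows "lie_bracket x y = 0"
proof -
  have "lie_bracket y x = 0"
    using assms unfolding derived_algebra_def
    by (rule linear_eq_0_on_span[OF linear_lie_bracket_right, rotated]) (auto simp: lie_bracket_2step)
  then show ?thesis using lie_bracket_antisym[of x y] by simp
qed

text \<open>The derived algebra is central, so the differential of a 1-form is a form on the
  abelianization.\<close>

lemma contract_ce_d_one_form:
  assumes "homogeneous 1 c" "x \<in> derived_algebra"
  shows "contract x (ce_d c) = 0"
proof (rule cochain_eqI)
  fix ys
  have *: "homogeneous 2 (ce_d c)"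
    using homogeneous_ce_d[OF assms(1)] by (simp add: numeral_2_eq_2)
  have "cochain_eval c [0] = 0"
    using cochain_eval[of c] linear_0[OF multilinear_form_Cons_linear[of "cochain_eval c" "[]"]] by simp
  then show "cochain_eval (contract x (ce_d c)) ys = cochain_eval 0 ys"
    using * assms(2)
    by (cases "length ys = 1")
      (auto simp: length_Suc_conv ce_d_1_form derived_algebra_central zero_cochain.rep_eq homogeneous_def)
qed

section \<open>Linear independence of finite families\<close>

text \<open>Independence is formulated for indexed families, because members given by different formulas
  (differentials and monomials) are not known in advance to be distinct.\<close>

lemma independent_family:
  assumes "finite I" and indep: "\<And>r. (\<Sum>i\<in>I. r i *\<^sub>R v i) = 0 \<Longrightarrow> \<forall>i\<in>I. r i = (0 :: real)"
  shows "inj_on v I" and "independent (v ` I)"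
proof -
  show inj: "inj_on v I"
  proof (rule inj_onI, rule ccontr)
    fix i j assume ij: "i \<in> I" "j \<in> I" "v i = v j" "i \<noteq> j"
    \<comment> \<open>A repeated vector would give the relation \<open>v i - v j = 0\<close>.\<close>
    let ?r = "\<lambda>l. (if l = i then 1 else 0) - (if l = j then 1 else 0 :: real)"
    have "(\<Sum>l\<in>I. ?r l *\<^sub>R v l) = (\<Sum>l\<in>I. (if l = i then v l else 0) - (if l = j then v l else 0))"
      by (rule sum.cong) auto
    then have "(\<Sum>l\<in>I. ?r l *\<^sub>R v l) = 0"
      using ij assms(1) by (simp add: sum_subtractf)
    from indep[OF this] ij show False by auto
  qed
  show "independent (v ` I)"
  proof (rule independent_if_scalars_zero)
    fix g w assume "(\<Sum>x\<in>v ` I. g x *\<^sub>R x) = 0" "w \<in> v ` I"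
    then show "g w = 0"
      using indep[of "\<lambda>i. g (v i)"] by (auto simp: sum.reindex[OF inj])
  qed (use assms in simp)
qed

lemma independent_family_card_le:
  assumes "finite I" "finite F" "v ` I \<subseteq> span F"
    and "\<And>r. (\<Sum>i\<in>I. r i *\<^sub>R v i) = 0 \<Longrightarrow> \<forall>i\<in>I. r i = (0 :: real)"
  shows "card I \<le> card F"
proof -
  have "inj_on v I" "independent (v ` I)"
    by (rule independent_family[OF assms(1)]; erule assms(4))+
  then show ?thesis
    using independent_span_bound[OF assms(2) _ assms(3)] by (simp add: card_image)
qed

section \<open>Monomials in a basis adapted to the derived algebra\<close>

text \<open>\<open>A\<close> is a basis of the derived algebra and \<open>E\<close> completes it to a basis of the Lie algebra, so
  that \<open>E\<close> projects to a basis of the abelianization.\<close>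

locale derived_basis =
  fixes A E :: "'a :: two_step_nilpotent_lie_algebra set"
  assumes finite_A: "finite A" and finite_E: "finite E" and disjoint: "A \<inter> E = {}"
    and independent: "independent (A \<union> E)" and span_basis: "span (A \<union> E) = UNIV"
    and span_A: "span A = derived_algebra"
begin

definition coord :: "'a \<Rightarrow> 'a cochain"
  where "coord b = one_form (\<lambda>x. representation (A \<union> E) x b)"

definition monomial :: "'a list \<Rightarrow> 'a cochain"
  where "monomial xs = foldr (\<lambda>b c. coord b \<and>\<^sub>c c) xs one_cochain"

lemma monomial_simps [simp]:
  "monomial [] = one_cochain" "monomial (b # xs) = coord b \<and>\<^sub>c monomial xs"
  by (simp_all add: monomial_def)

lemma linear_representation: "linear (\<lambda>x. representation (A \<union> E) x b)"
  using independent span_basis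
  by (intro linearI) (simp_all add: representation_add representation_scale)

lemma coord_eval: "cochain_eval (coord b) [x] = representation (A \<union> E) x b"
  by (simp add: coord_def one_form.rep_eq linear_representation)

lemma homogeneous_coord: "homogeneous 1 (coord b)"
  unfolding coord_def by (rule homogeneous_one_form)

lemma monomial_append: "monomial xs \<and>\<^sub>c monomial ys = monomial (xs @ ys)"
  by (induction xs) (simp_all add: wedge_one_left wedge_assoc)

lemma coord_wedge_self: "coord b \<and>\<^sub>c (coord b \<and>\<^sub>c c) = 0"
  unfolding coord_def by (rule one_form_wedge_self)

lemma coord_wedge_anticommute: "coord a \<and>\<^sub>c (coord b \<and>\<^sub>c c) = - (coord b \<and>\<^sub>c (coord a \<and>\<^sub>c c))"
  unfolding coord_def by (intro one_form_wedge_anticommute linear_representation)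

lemma wedge_minus_right: "c \<and>\<^sub>c (- e) = - (c \<and>\<^sub>c e)"
  by (rule linear_neg[OF linear_wedge(2)])

lemma monomial_move_to_front:
  "monomial (us @ x # vs) = monomial (x # us @ vs) \<or>
   monomial (us @ x # vs) = - monomial (x # us @ vs)"
proof (induction us)
  case (Cons u us)
  then show ?case
    using coord_wedge_anticommute[of u x "monomial (us @ vs)"]
    by (auto simp: wedge_minus_right)
qed simp

lemma monomial_permute:
  assumes "mset xs = mset ys"
  shows "monomial xs = monomial ys \<or> monomial xs = - monomial ys"
  using assms
proof (induction ys arbitrary: xs)
  case (Cons y ys)
  then obtain us vs where xs: "xs = us @ y # vs"
    by (metis list.set_intros(1) set_mset_mset split_list)
  with Cons.prems have "mset (us @ vs) = mset ys" by simp
  from Cons.IH[OF this] show ?case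
    using monomial_move_to_front[of us y vs] by (auto simp: xs wedge_minus_right)
qed simp

lemma monomial_not_distinct:
  assumes "\<not> distinct xs"
  shows "monomial xs = 0"
proof -
  obtain us x ws vs where xs: "xs = us @ [x] @ ws @ [x] @ vs"
    using not_distinct_decomp[OF assms] by blast
  have "monomial xs = monomial (x # x # us @ ws @ vs) \<or>
      monomial xs = - monomial (x # x # us @ ws @ vs)"
    by (rule monomial_permute) (simp add: xs)
  then show ?thesis by (auto simp: coord_wedge_self)
qed

text \<open>The monomial of a set is defined only up to sign, so an arbitrary enumeration is chosen.\<close>

definition set_monomial :: "'a set \<Rightarrow> 'a cochain"
  where "set_monomial S = monomial (SOME xs. distinct xs \<and> set xs = S)"

lemma set_monomial_obtain:
  assumes "finite S"
  obtains xs where "distinct xs" "set xs = S" "set_monomial S = monomial xs"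
  using someI_ex[of "\<lambda>xs. distinct xs \<and> set xs = S"] finite_distinct_list[OF assms]
  unfolding set_monomial_def by blast

lemma set_monomial_eq:
  assumes "distinct xs"
  shows "monomial xs = set_monomial (set xs) \<or> monomial xs = - set_monomial (set xs)"
proof -
  obtain ys where ys: "distinct ys" "set ys = set xs" "set_monomial (set xs) = monomial ys"
    using set_monomial_obtain[of "set xs"] by auto
  then show ?thesis
    using monomial_permute[of xs ys] assms by (simp add: set_eq_iff_mset_eq_distinct)
qed

lemma set_monomial_wedge:
  assumes "finite S" "finite T"
  shows "S \<inter> T \<noteq> {} \<Longrightarrow> set_monomial S \<and>\<^sub>c set_monomial T = 0"
    and "S \<inter> T = {} \<Longrightarrow> set_monomial S \<and>\<^sub>c set_monomial T = set_monomial (S \<union> T) \<or>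
           set_monomial S \<and>\<^sub>c set_monomial T = - set_monomial (S \<union> T)"
proof -
  obtain xs ys where
    xs: "distinct xs" "set xs = S" "set_monomial S = monomial xs" and
    ys: "distinct ys" "set ys = T" "set_monomial T = monomial ys"
    using set_monomial_obtain assms by metis
  show "set_monomial S \<and>\<^sub>c set_monomial T = 0" if "S \<inter> T \<noteq> {}"
    using that xs ys monomial_not_distinct[of "xs @ ys"] by (simp add: monomial_append)
  show "set_monomial S \<and>\<^sub>c set_monomial T = set_monomial (S \<union> T) \<or>
           set_monomial S \<and>\<^sub>c set_monomial T = - set_monomial (S \<union> T)" if "S \<inter> T = {}"
    using that xs ys set_monomial_eq[of "xs @ ys"] by (simp add: monomial_append)
qed

subsection \<open>Basic forms\<close>

text \<open>A form killed by contraction with the derived algebra is a form on the abelianization.  The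
  next lemmas show that such forms are combinations of monomials in the coordinates of \<open>E\<close>.\<close>

lemma span_coord_wedge:
  assumes "c \<in> span (monomial ` {xs. set xs \<subseteq> E \<and> length xs = k})" "b \<in> E"
  shows "coord b \<and>\<^sub>c c \<in> span (monomial ` {xs. set xs \<subseteq> E \<and> length xs = Suc k})"
proof -
  have "(\<lambda>c. coord b \<and>\<^sub>c c) ` monomial ` {xs. set xs \<subseteq> E \<and> length xs = k}
      \<subseteq> monomial ` {xs. set xs \<subseteq> E \<and> length xs = Suc k}"
  proof (safe, goal_cases)
    case (1 c d xs)
    then show ?case using assms(2) by (intro image_eqI[of _ _ "b # xs"]) auto
  qed
  then have "span ((\<lambda>c. coord b \<and>\<^sub>c c) ` monomial ` {xs. set xs \<subseteq> E \<and> length xs = k})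
      \<subseteq> span (monomial ` {xs. set xs \<subseteq> E \<and> length xs = Suc k})"
    by (rule span_mono)
  then show ?thesis
    using assms(1) linear_span_image[OF linear_wedge(2)] by blast
qed

text \<open>By Euler's identity, \<open>k\<close> times a \<open>k\<close>-form is the sum over the basis of coordinate times
  contraction.  The terms of the derived algebra vanish, and the contractions in the other terms
  are covered by induction on the degree.\<close>

lemma basic_form_in_span_monomial:
  assumes "homogeneous k c" "\<And>x. x \<in> A \<Longrightarrow> contract x c = 0"
  shows "c \<in> span (monomial ` {xs. set xs \<subseteq> E \<and> length xs = k})"
  using assms
proof (induction k arbitrary: c)
  case 0
  have "c = cochain_eval c [] *\<^sub>R one_cochain"
    using 0 by (intro cochain_eqI)
      (auto simp: scaleR_cochain.rep_eq one_cochain.rep_eq homogeneous_def)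
  moreover have "one_cochain \<in> monomial ` {xs. set xs \<subseteq> E \<and> length xs = 0}"
    by (intro image_eqI[of _ _ "[]"]) auto
  ultimately show ?case by (metis span_base span_scale)
next
  case (Suc k)
  have contr: "contract b c \<in> span (monomial ` {xs. set xs \<subseteq> E \<and> length xs = k})" for b
  proof (rule Suc.IH)
    show "homogeneous k (contract b c)"
      using Suc.prems(1) by (simp add: homogeneous_def)
    show "contract x (contract b c) = 0" if "x \<in> A" for x
      using contract_swap[of x b c] Suc.prems(2)[OF that] contract_scaleR[of b 0 0] by simp
  qed
  have "real (Suc k) *\<^sub>R c = (\<Sum>b\<in>A \<union> E. coord b \<and>\<^sub>c contract b c)"
    unfolding coord_def
    by (rule homogeneous_eq_sum_wedge) (use finite_A finite_E independent span_basis Suc in auto)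
  also have "\<dots> = (\<Sum>b\<in>E. coord b \<and>\<^sub>c contract b c)"
    by (rule sum.mono_neutral_right) (use finite_A finite_E Suc.prems in auto)
  also have "\<dots> \<in> span (monomial ` {xs. set xs \<subseteq> E \<and> length xs = Suc k})"
    by (intro span_sum span_coord_wedge contr)
  finally have "(1 / real (Suc k)) *\<^sub>R real (Suc k) *\<^sub>R c
      \<in> span (monomial ` {xs. set xs \<subseteq> E \<and> length xs = Suc k})"
    by (rule span_scale)
  then show ?case by simp
qed

lemma basic_form_in_span_set_monomial:
  assumes "homogeneous k c" "\<And>x. x \<in> A \<Longrightarrow> contract x c = 0"
  shows "c \<in> span (set_monomial ` {S. S \<subseteq> E \<and> card S = k})"
proof -
  have "monomial xs \<in> span (set_monomial ` {S. S \<subseteq> E \<and> card S = k})"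
    if "set xs \<subseteq> E" "length xs = k" for xs
  proof (cases "distinct xs")
    case True
    then have "set_monomial (set xs) \<in> span (set_monomial ` {S. S \<subseteq> E \<and> card S = k})"
      using that by (intro span_base imageI) (simp add: distinct_card)
    then show ?thesis using set_monomial_eq[OF True] by (auto intro: span_neg)
  next
    case False
    then show ?thesis by (simp add: monomial_not_distinct span_zero)
  qed
  then have "span (monomial ` {xs. set xs \<subseteq> E \<and> length xs = k})
      \<subseteq> span (set_monomial ` {S. S \<subseteq> E \<and> card S = k})"
    by (intro span_minimal) auto
  with basic_form_in_span_monomial[OF assms] show ?thesis by blast
qed

lemma coord_derived_algebra:
  assumes "b \<in> E" "x \<in> derived_algebra"
  shows "cochain_eval (coord b) [x] = 0"
proof -
  have "b \<notin> A" using disjoint assms(1) by blast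
  then have *: "representation (A \<union> E) a b = 0" if "a \<in> A" for a
    using that independent by (auto simp: representation_basis)
  show ?thesis
    unfolding coord_eval
    by (rule linear_eq_0_on_span[OF linear_representation, of A]) (use * assms span_A in auto)
qed

lemma ce_d_coord:
  assumes "b \<in> E" shows "ce_d (coord b) = 0"
proof (rule cochain_eqI)
  fix xs
  have *: "homogeneous 2 (ce_d (coord b))"
    using homogeneous_ce_d[OF homogeneous_coord] by (simp add: numeral_2_eq_2)
  show "cochain_eval (ce_d (coord b)) xs = cochain_eval 0 xs"
  proof (cases "length xs = 2")
    case True
    then obtain x y where "xs = [x, y]" by (auto simp: length_Suc_conv numeral_2_eq_2)
    then show ?thesis
      by (simp add: ce_d_1_form coord_derived_algebra assms lie_bracket_in_derived_algebra
          zero_cochain.rep_eq)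
  next
    case False
    then show ?thesis using * by (simp add: homogeneous_def zero_cochain.rep_eq)
  qed
qed

lemma ce_d_monomial: "set xs \<subseteq> E \<Longrightarrow> ce_d (monomial xs) = 0"
  by (induction xs) (simp_all add: ce_d_one_cochain ce_d_wedge[OF homogeneous_coord] ce_d_coord)

lemma ce_d_set_monomial:
  assumes "S \<subseteq> E" shows "ce_d (set_monomial S) = 0"
  using set_monomial_obtain[of S] finite_subset[OF assms finite_E] ce_d_monomial assms by metis

lemma A_subset_derived_algebra: "A \<subseteq> derived_algebra"
  using span_A span_superset by blast

section \<open>The counting argument\<close>

text \<open>The family consists of the differentials of the coordinates of \<open>A\<close> and the monomials of the pairs
  in \<open>S\<close>; it lies in the span of the monomials of the pairs in \<open>E\<close>.  If \<open>S\<close> carries a non-exact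
  monomial, multiplying by complementary monomials shows that the family is independent.\<close>

lemma non_exact_monomial_bound:
  assumes S: "S \<subseteq> E" and non_exact: "set_monomial S \<notin> range ce_d"
  shows "card A + (card S choose 2) \<le> card E choose 2"
proof -
  define pairs where "pairs T = {P. P \<subseteq> T \<and> card P = 2}" for T :: "'a set"
  define v where "v = case_sum (\<lambda>a. ce_d (coord a)) set_monomial"
  note fin = finite_subset[OF S finite_E]
  have fin_pairs: "finite (pairs T)" if "finite T" for T
    using that by (simp add: pairs_def)
  have card_pairs: "card (pairs T) = card T choose 2" if "finite T" for T
    using n_subsets[OF that] by (simp add: pairs_def)
  have "card (A <+> pairs S) \<le> card (set_monomial ` pairs E)"
  proof (rule independent_family_card_le[where v = v])
    show "finite (A <+> pairs S)" "finite (set_monomial ` pairs E)"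
      using finite_A finite_E fin fin_pairs by auto
    have "ce_d (coord a) \<in> span (set_monomial ` pairs E)" for a
      unfolding pairs_def
      by (rule basic_form_in_span_set_monomial)
        (use homogeneous_ce_d[OF homogeneous_coord] contract_ce_d_one_form[OF homogeneous_coord]
          A_subset_derived_algebra in \<open>auto simp: numeral_2_eq_2\<close>)
    moreover have "set_monomial P \<in> span (set_monomial ` pairs E)" if "P \<in> pairs S" for P
      using that S by (intro span_base imageI) (auto simp: pairs_def)
    ultimately show "v ` (A <+> pairs S) \<subseteq> span (set_monomial ` pairs E)"
      by (auto simp: v_def)
  next
    fix r assume sum0: "(\<Sum>i\<in>A <+> pairs S. r i *\<^sub>R v i) = 0"
    define \<phi> where "\<phi> = (\<Sum>a\<in>A. r (Inl a) *\<^sub>R coord a)"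
    define \<omega> where "\<omega> = (\<Sum>P\<in>pairs S. r (Inr P) *\<^sub>R set_monomial P)"
    have hom: "homogeneous 1 \<phi>"
      unfolding \<phi>_def by (intro homogeneous_sum homogeneous_coord)
    have rel: "ce_d \<phi> + \<omega> = 0"
      using sum0 finite_A fin_pairs[OF fin]
      by (simp add: sum.Plus v_def \<phi>_def \<omega>_def linear_sum[OF linear_ce_d] linear_scale[OF linear_ce_d])
    have pair0: "r (Inr P) = 0" if P: "P \<in> pairs S" for P
    proof (rule ccontr)
      assume nz: "r (Inr P) \<noteq> 0"
      define N where "N = set_monomial (S - P)"
      have fP: "finite Q" "card Q = 2" "Q \<subseteq> S" if "Q \<in> pairs S" for Q
        using that finite_subset[OF _ fin] by (auto simp: pairs_def)
      \<comment> \<open>A pair in \<open>S\<close> that misses \<open>S - P\<close> lies in \<open>P\<close>, so it is \<open>P\<close>.\<close>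
      have "set_monomial Q \<and>\<^sub>c N = 0" if Q: "Q \<in> pairs S" "Q \<noteq> P" for Q
        unfolding N_def
      proof (rule set_monomial_wedge(1))
        show "Q \<inter> (S - P) \<noteq> {}"
          using fP[OF Q(1)] fP[OF P] Q(2) card_subset_eq[of P Q] by auto
      qed (use fP[OF Q(1)] fin in auto)
      then have "\<omega> \<and>\<^sub>c N = (\<Sum>Q\<in>pairs S. if Q = P then r (Inr P) *\<^sub>R (set_monomial P \<and>\<^sub>c N) else 0)"
        unfolding \<omega>_def linear_sum[OF linear_wedge(1)]
        by (intro sum.cong) (auto simp: wedge_scaleR)
      also have "\<dots> = r (Inr P) *\<^sub>R (set_monomial P \<and>\<^sub>c N)"
        using P fin_pairs[OF fin] by simp
      finally have \<omega>N: "\<omega> \<and>\<^sub>c N = r (Inr P) *\<^sub>R (set_monomial P \<and>\<^sub>c N)" .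
      have "ce_d (\<phi> \<and>\<^sub>c N) = ce_d \<phi> \<and>\<^sub>c N"
        unfolding ce_d_wedge[OF hom] N_def using S by (simp add: ce_d_set_monomial subset_iff)
      also have "ce_d \<phi> = - \<omega>" using rel by (simp add: eq_neg_iff_add_eq_0)
      also have "(- \<omega>) \<and>\<^sub>c N = - (\<omega> \<and>\<^sub>c N)" by (rule linear_neg[OF linear_wedge(1)])
      finally have "ce_d (\<phi> \<and>\<^sub>c N) = - (r (Inr P) *\<^sub>R (set_monomial P \<and>\<^sub>c N))"
        unfolding \<omega>N .
      then have "set_monomial P \<and>\<^sub>c N = ce_d ((- (1 / r (Inr P))) *\<^sub>R (\<phi> \<and>\<^sub>c N))"
        using nz by (simp only: ce_d_linear_simps) simp
      then have "set_monomial P \<and>\<^sub>c N \<in> range ce_d" by blast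
      moreover have "P \<union> (S - P) = S" using fP(3)[OF P] by blast
      ultimately have "set_monomial S \<in> range ce_d \<or> - set_monomial S \<in> range ce_d"
        using set_monomial_wedge(2)[of P "S - P"] fP[OF P] fin unfolding N_def by auto
      then show False
        using non_exact subspace_neg[OF subspace_range_ce_d, of "- set_monomial S"] by simp
    qed
    then have "\<omega> = 0" by (simp add: \<omega>_def)
    then have closed: "ce_d \<phi> = 0" using rel by simp
    have form0: "r (Inl a) = 0" if a: "a \<in> A" for a
    proof -
      have "cochain_eval \<phi> [a] = 0"
        using closed_one_form_vanishes[OF closed] a A_subset_derived_algebra by blast
      moreover have "cochain_eval \<phi> [a] = (\<Sum>a'\<in>A. if a' = a then r (Inl a) else 0)"
        unfolding \<phi>_def cochain_eval_sum
        using a independent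
        by (intro sum.cong) (auto simp: scaleR_cochain.rep_eq coord_eval representation_basis)
      ultimately show ?thesis using a finite_A by simp
    qed
    show "\<forall>i\<in>A <+> pairs S. r i = 0"
      using pair0 form0 by auto
  qed
  also have "\<dots> \<le> card (pairs E)"
    by (rule card_image_le) (rule fin_pairs[OF finite_E])
  finally show ?thesis
    using finite_A fin fin_pairs[OF fin] card_pairs finite_E by (simp add: card_Plus)
qed

end

section \<open>Cohomology classes\<close>

lemma abs_cohomology_eq_0_iff:
  assumes "ce_d c = 0"
  shows "abs_cohomology c = 0 \<longleftrightarrow> c \<in> range ce_d"
proof -
  have "abs_cohomology c = abs_cohomology 0 \<longleftrightarrow> cohomologous c 0"
    using Quotient3_rel[OF Quotient3_cohomology, of c 0] assms
    by (simp add: cohomologous_refl ce_d_linear_simps)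
  then show ?thesis
    by (simp add: zero_cohomology_def cohomologous_def assms ce_d_linear_simps)
qed

context derived_basis
begin

text \<open>There are no nonzero exact 1-forms, so the first Betti number counts the closed ones.\<close>

lemma betti_1: "betti TYPE('a) 1 = card E"
proof -
  define u where "u b = abs_cohomology (coord b)" for b
  have cl: "ce_d (\<Sum>b\<in>F. r b *\<^sub>R coord b) = 0" if "F \<subseteq> E" for r F
    using that by (simp add: linear_sum[OF linear_ce_d] ce_d_linear_simps ce_d_coord subset_iff)
  have abs_sum: "abs_cohomology (\<Sum>b\<in>F. r b *\<^sub>R coord b) = (\<Sum>b\<in>F. r b *\<^sub>R u b)" if "F \<subseteq> E" for r F
    using finite_subset[OF that finite_E] that
  proof (induction F rule: finite_induct)
    case empty
    then show ?case by (simp add: zero_cohomology_def)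
  next
    case (insert b F)
    then show ?case
      using cl[of F r]
      by (simp add: u_def plus_cohomology.abs_eq[symmetric] scaleR_cohomology.abs_eq[symmetric]
          cohomologous_refl ce_d_linear_simps ce_d_coord)
  qed
  have exact_singleton: "cochain_eval (ce_d h) [x] = 0" for h :: "'a cochain" and x
    by (simp add: ce_d.rep_eq ce_d_fun_def)
  have indep: "\<forall>b\<in>E. r b = 0" if "(\<Sum>b\<in>E. r b *\<^sub>R u b) = 0" for r
  proof
    fix b assume b: "b \<in> E"
    have "abs_cohomology (\<Sum>b\<in>E. r b *\<^sub>R coord b) = 0"
      using abs_sum that by simp
    then obtain h where "(\<Sum>b\<in>E. r b *\<^sub>R coord b) = ce_d h"
      using abs_cohomology_eq_0_iff[OF cl[of E r]] by blast
    then have "cochain_eval (\<Sum>b\<in>E. r b *\<^sub>R coord b) [b] = 0"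
      using exact_singleton by simp
    moreover have "cochain_eval (\<Sum>b\<in>E. r b *\<^sub>R coord b) [b] = (\<Sum>b'\<in>E. if b' = b then r b else 0)"
      unfolding cochain_eval_sum
      using b independent
      by (intro sum.cong) (auto simp: scaleR_cochain.rep_eq coord_eval representation_basis)
    ultimately show "r b = 0" using b finite_E by simp
  qed
  have spans: "cohomology_degree 1 \<subseteq> span (u ` E)"
  proof
    fix h :: "'a cohomology" assume "h \<in> cohomology_degree 1"
    then obtain c where c: "homogeneous 1 c" "ce_d c = 0" "h = abs_cohomology c"
      by (auto simp: cohomology_degree_def)
    note lin = linear_cochain_eval_singleton[of c]
    have van: "cochain_eval c [x] = 0" if "x \<in> A" for x
      using closed_one_form_vanishes[OF c(2)] that A_subset_derived_algebra by blast
    have "c = (\<Sum>b\<in>E. cochain_eval c [b] *\<^sub>R coord b)"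
    proof (rule cochain_eqI)
      fix xs
      show "cochain_eval c xs = cochain_eval (\<Sum>b\<in>E. cochain_eval c [b] *\<^sub>R coord b) xs"
      proof (cases "length xs = 1")
        case True
        then obtain x where xs: "xs = [x]" by (auto simp: length_Suc_conv)
        have "x = (\<Sum>b\<in>A \<union> E. representation (A \<union> E) x b *\<^sub>R b)"
          using sum_representation_eq[of "A \<union> E" x "A \<union> E"] independent span_basis finite_A finite_E
          by simp
        then have "cochain_eval c [x] =
            (\<Sum>b\<in>A \<union> E. representation (A \<union> E) x b * cochain_eval c [b])"
          using linear_sum[OF lin, of "\<lambda>b. representation (A \<union> E) x b *\<^sub>R b" "A \<union> E"]
            linear_scale[OF lin] by simp
        also have "\<dots> = (\<Sum>b\<in>E. representation (A \<union> E) x b * cochain_eval c [b])"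
          by (rule sum.mono_neutral_right) (use finite_A finite_E van in auto)
        finally show ?thesis
          by (simp add: xs cochain_eval_sum scaleR_cochain.rep_eq coord_eval mult.commute)
      next
        case False
        then show ?thesis
          using c(1) homogeneous_coord
          by (simp add: cochain_eval_sum scaleR_cochain.rep_eq homogeneous_def)
      qed
    qed
    then have "h = (\<Sum>b\<in>E. cochain_eval c [b] *\<^sub>R u b)"
      using abs_sum[of E "\<lambda>b. cochain_eval c [b]"] c(3) by simp
    then show "h \<in> span (u ` E)"
      by (simp add: span_sum span_scale span_base)
  qed
  have inj: "inj_on u E" and "independent (u ` E)"
    using independent_family[OF finite_E indep] by auto
  then have "dim (cohomology_degree 1 :: 'a cohomology set) = card (u ` E)"
    using spans homogeneous_coord
    by (intro dim_unique[of "u ` E"])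
      (auto simp: cohomology_degree_def u_def ce_d_coord)
  then show ?thesis by (simp add: betti_def card_image inj)
qed

text \<open>The exact forms are a subspace, so if all monomials of degree \<open>k\<close> were exact, every form pulled
  back from the abelianization would be.\<close>

lemma basic_betti_nonzero_imp_non_exact_monomial:
  assumes "basic_betti TYPE('a) k \<noteq> 0"
  obtains S where "S \<subseteq> E" "card S = k" "set_monomial S \<notin> range ce_d"
proof -
  have "\<not> (basic_cohomology_degree k :: 'a cohomology set) \<subseteq> {0}"
  proof
    assume "(basic_cohomology_degree k :: 'a cohomology set) \<subseteq> {0}"
    then have "dim (basic_cohomology_degree k :: 'a cohomology set) = 0"
      by (intro dim_unique[of "{}"]) (auto simp: independent_empty)
    then show False using assms by (simp add: basic_betti_def)
  qed
  then obtain c :: "'a abelianization cochain" where c: "homogeneous k c" "ce_d c = 0"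
      "cohomology_pullback (abs_cohomology c) \<noteq> 0"
    by (auto simp: basic_cohomology_degree_def cohomology_degree_def)
  define e where "e = cochain_pullback c"
  have "ce_d e = 0"
    by (simp add: e_def ce_d_cochain_pullback c(2) linear_0[OF linear_cochain_pullback])
  moreover have "abs_cohomology e \<noteq> 0"
    using c(3) by (simp add: e_def cohomology_pullback.abs_eq cohomologous_refl c(2))
  ultimately have non_exact: "e \<notin> range ce_d"
    using abs_cohomology_eq_0_iff by blast
  have "homogeneous k e"
    using c(1) by (simp add: e_def homogeneous_def cochain_pullback.rep_eq)
  moreover have "contract x e = 0" if "x \<in> A" for x
  proof (rule cochain_eqI)
    fix ys
    have "abs_abelianization x = (abs_abelianization 0 :: 'a abelianization)"
      using that A_subset_derived_algebra by (auto simp: abelianization.abs_eq_iff derived_rel_def)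
    then have "abs_abelianization x = (0 :: 'a abelianization)"
      by (simp add: linear_0[OF linear_abs_abelianization])
    moreover have "cochain_eval c (0 # map abs_abelianization ys) = 0"
      using cochain_eval[of c] by (intro linear_0[OF multilinear_form_Cons_linear]) simp
    ultimately show "cochain_eval (contract x e) ys = cochain_eval 0 ys"
      by (simp add: e_def cochain_pullback.rep_eq zero_cochain.rep_eq)
  qed
  ultimately have "e \<in> span (set_monomial ` {S. S \<subseteq> E \<and> card S = k})"
    by (rule basic_form_in_span_set_monomial)
  moreover have "span (set_monomial ` {S. S \<subseteq> E \<and> card S = k}) \<subseteq> range ce_d"
    if "\<And>S. S \<subseteq> E \<Longrightarrow> card S = k \<Longrightarrow> set_monomial S \<in> range ce_d"
    using that by (intro span_minimal subspace_range_ce_d) auto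
  ultimately show thesis using non_exact that by blast
qed

text \<open>Degree 0 shows that the maximum defining the independence number is taken over a nonempty set.\<close>

lemma basic_betti_0: "basic_betti TYPE('a) 0 \<noteq> 0"
proof -
  let ?u = "abs_cohomology (one_cochain :: 'a cochain)"
  have pull: "cochain_pullback one_cochain = (one_cochain :: 'a cochain)"
    by (rule cochain_eqI) (simp add: cochain_pullback.rep_eq one_cochain.rep_eq)
  note closed = ce_d_one_cochain
  have pull_u: "cohomology_pullback (abs_cohomology one_cochain) = ?u"
    by (simp add: cohomology_pullback.abs_eq cohomologous_refl closed pull)
  have "cochain_eval (one_cochain :: 'a cochain) [] = 1" "cochain_eval (ce_d h) [] = 0"
    for h :: "'a cochain"
    by (simp_all add: one_cochain.rep_eq ce_d.rep_eq)
  then have "(one_cochain :: 'a cochain) \<notin> range ce_d" by (metis rangeE zero_neq_one)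
  then have nz: "?u \<noteq> 0" using abs_cohomology_eq_0_iff[OF closed] by blast
  have mem: "?u \<in> basic_cohomology_degree 0"
    unfolding basic_cohomology_degree_def cohomology_degree_def
    by (rule image_eqI[where x = "abs_cohomology one_cochain"])
      (simp_all add: pull_u homogeneous_one_cochain closed)
  have "h \<in> span {?u}" if "h \<in> basic_cohomology_degree 0" for h
  proof -
    from that obtain c :: "'a abelianization cochain" where
      c: "homogeneous 0 c" "h = cohomology_pullback (abs_cohomology c)"
      by (auto simp: basic_cohomology_degree_def cohomology_degree_def)
    have "c = cochain_eval c [] *\<^sub>R one_cochain"
      using c by (intro cochain_eqI)
        (auto simp: scaleR_cochain.rep_eq one_cochain.rep_eq homogeneous_def)
    then obtain r where "c = r *\<^sub>R one_cochain" by blast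
    then have "h = r *\<^sub>R ?u"
      by (simp add: c(2) cohomology_pullback.abs_eq cohomologous_refl ce_d_linear_simps closed pull
          linear_scale[OF linear_cochain_pullback] scaleR_cohomology.abs_eq)
    then show ?thesis by (simp add: span_scale span_base)
  qed
  then have "dim (basic_cohomology_degree 0 :: 'a cohomology set) = 1"
    using mem nz by (intro dim_unique[of "{?u}"]) auto
  then show ?thesis by (simp add: basic_betti_def)
qed

end

section \<open>The bound on the independence number\<close>

lemma obtain_derived_basis:
  assumes "\<exists>B :: 'a :: two_step_nilpotent_lie_algebra set. finite B \<and> span B = UNIV"
  obtains A E :: "'a :: two_step_nilpotent_lie_algebra set" where "derived_basis A E"
proof -
  obtain B0 :: "'a set" where B0: "finite B0" "span B0 = UNIV" using assms by blast
  obtain A :: "'a set" where A: "A \<subseteq> derived_algebra" "independent A" "derived_algebra \<subseteq> span A"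
    by (rule maximal_independent_subset)
  obtain B where B: "A \<subseteq> B" "independent B" "UNIV \<subseteq> span B"
    by (rule maximal_independent_subset_extend[OF subset_UNIV A(2)])
  have "finite B"
    using independent_span_bound[OF B0(1) B(2)] B0(2) by simp
  moreover have "A \<union> (B - A) = B" using B(1) by blast
  moreover have "span A = derived_algebra"
    using span_minimal[OF A(1) subspace_derived_algebra] A(3) by blast
  moreover have "span B = UNIV" using B(3) by blast
  ultimately have "derived_basis A (B - A)"
    using B(2) finite_subset[OF B(1)] by (simp add: derived_basis_def)
  then show thesis by (rule that)
qed

theorem theorem28:
  fixes b d :: nat
  assumes "\<exists>B :: 'a :: two_step_nilpotent_lie_algebra set. finite B \<and> span B = UNIV"
    and "dim (UNIV :: 'a set) = d"
    and "betti TYPE('a) 1 = b"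
  shows "real (independence_number TYPE('a)) \<le>
           1 / 2 + sqrt (1 / 4 + (real b)\<^sup>2 + real b - 2 * real d)"
proof -
  obtain A E :: "'a set" where AE: "derived_basis A E"
    using obtain_derived_basis[OF assms(1)] by blast
  interpret derived_basis A E by (rule AE)
  define \<alpha> where "\<alpha> = independence_number TYPE('a)"
  have card_le: "k \<le> card E" if "basic_betti TYPE('a) k \<noteq> 0" for k
    using basic_betti_nonzero_imp_non_exact_monomial[OF that] card_mono[OF finite_E] by metis
  have "basic_betti TYPE('a) \<alpha> \<noteq> 0"
    unfolding \<alpha>_def independence_number_def
    by (rule GreatestI_nat[where P = "\<lambda>k. basic_betti TYPE('a) k \<noteq> 0", OF basic_betti_0 card_le])
  then obtain S where S: "S \<subseteq> E" "card S = \<alpha>" "set_monomial S \<notin> range ce_d"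
    using basic_betti_nonzero_imp_non_exact_monomial by blast
  have b: "card E = b" using betti_1 assms(3) by simp
  have "d = card (A \<union> E)"
    using basis_card_eq_dim[of "A \<union> E" UNIV] independent span_basis assms(2) by simp
  then have d: "d = card A + b"
    using finite_A finite_E disjoint b by (simp add: card_Un_disjoint)
  have double_choose: "2 * real (n choose 2) = real n * (real n - 1)" for n
    by (induction n) (simp_all add: numeral_2_eq_2 algebra_simps)
  have "real (card A) + real (\<alpha> choose 2) \<le> real (b choose 2)"
    using non_exact_monomial_bound[OF S(1,3)] unfolding S(2) b by linarith
  then have "2 * (real d - real b) + real \<alpha> * (real \<alpha> - 1) \<le> real b * (real b - 1)"
    using double_choose[of \<alpha>] double_choose[of b] d by simp
  then have "(real \<alpha> - 1 / 2)\<^sup>2 \<le> 1 / 4 + (real b)\<^sup>2 + real b - 2 * real d"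
    by (simp add: power2_eq_square algebra_simps)
  then have "real \<alpha> - 1 / 2 \<le> sqrt (1 / 4 + (real b)\<^sup>2 + real b - 2 * real d)"
    by (rule real_le_rsqrt)
  then show ?thesis by (simp add: \<alpha>_def)
qed

end
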